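(* Let $\kappa>0$, $R>0$, and let $\boldsymbol J\in H_0(\mathrm{div};B_R)$ be a source with compact support contained in $B_R$. Then $\boldsymbol J$ is nonradiating if and only if $\boldsymbol J\in\mathcal N_2(R)$.
   Context: $B_R=\{x\in\mathbb R^3:|x|<R\}$, $\kappa>0$ is the wavenumber, $g(x,y)=\frac{e^{\mathrm i\kappa|x-y|}}{4\pi|x-y|}$, and $\boldsymbol G(x,y)=[\boldsymbol I+\kappa^{-2}\nabla\nabla]g(x,y)$ is the $3\times3$ dyadic Green's tensor of Maxwell's equations ($\nabla\nabla$ is the Hessian). The electric field generated by $\boldsymbol J$ is $\boldsymbol E(x)=\int_{B_R}\boldsymbol G(x,y)\boldsymbol J(y)\,\mathrm dy$, the solution of $\nabla\times(\nabla\times\boldsymbol E)-\kappa^2\boldsymbol E=\boldsymbol J$ satisfying the Silver--Müller radiation condition. A source $\boldsymbol J$ with compact support contained in $B_R$ is called nonradiating if this $\boldsymbol E$ is identically zero outside $B_R$. $H_0(\mathrm{div};B_R)=\{\boldsymbol\Psi\in(L^2(B_R))^3:\nabla\cdot\boldsymbol\Psi\in L^2(B_R),\ (\boldsymbol\Psi\cdot\boldsymbol n)|_{\partial B_R}=0\}$, where $\boldsymbol n$ is the outward unit normal on $\partial B_R$. Let $j_0$ be the spherical Bessel function of order $0$. A source $\boldsymbol J\in H_0(\mathrm{div};B_R)$ belongs to the null space $\mathcal N_2(R)$ if $$\int_{B_R}j_0(\kappa|x-y|)\boldsymbol J(y)\,\mathrm dy-\kappa^{-2}\int_{B_R}\nabla_yj_0(\kappa|x-y|)\,\nabla\cdot\boldsymbol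 J(y)\,\mathrm dy=0\quad\text{for all }|x|>R.$$ *)

theory Defs
  imports "HOL-Analysis.Analysis"
begin

text \<open>
  Sources are complex vector fields \<open>real^3 \<Rightarrow> complex^3\<close>. A field on an open set \<open>\<Omega>\<close> is
  represented by a total function whose values outside \<open>\<Omega>\<close> are irrelevant. All products of
  complex vectors below are bilinear (no conjugation).
\<close>

section \<open>Differential operators\<close>

definition partial :: "'n::finite \<Rightarrow> (real^'n \<Rightarrow> 'b::real_normed_vector) \<Rightarrow> real^'n \<Rightarrow> 'b" where
  "partial i f x = frechet_derivative f (at x) (axis i 1)"

definition grad :: "(real^'n::finite \<Rightarrow> complex) \<Rightarrow> real^'n \<Rightarrow> complex^'n" where
  "grad f x = (\<chi> i. partial i f x)"

definition hessian :: "(real^'n::finite \<Rightarrow> complex) \<Rightarrow> real^'n \<Rightarrow> complex^'n^'n" where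
  "hessian f x = (\<chi> i j. partial i (partial j f) x)"

primrec Ck :: "nat \<Rightarrow> (real^'n::finite \<Rightarrow> complex) \<Rightarrow> bool" where
  "Ck 0 f \<longleftrightarrow> continuous_on UNIV f"
| "Ck (Suc k) f \<longleftrightarrow> (\<forall>x. f differentiable (at x)) \<and> (\<forall>i. Ck k (partial i f))"

definition smooth :: "(real^'n::finite \<Rightarrow> complex) \<Rightarrow> bool" where
  "smooth f \<longleftrightarrow> (\<forall>k. Ck k f)"

text \<open>\<open>C_c^\<infinity>(\<Omega>)\<close>, each function being extended by zero to the whole space.\<close>

definition test_function :: "(real^'n::finite) set \<Rightarrow> (real^'n \<Rightarrow> complex) \<Rightarrow> bool" where
  "test_function \<Omega> \<phi> \<longleftrightarrow>
     smooth \<phi> \<and> compact (closure {x. \<phi> x \<noteq> 0}) \<and> closure {x. \<phi> x \<noteq> 0} \<subseteq> \<Omega>"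

section \<open>The space $H_0(\mathrm{div})$\<close>

definition L2 :: "'a::euclidean_space set \<Rightarrow> ('a \<Rightarrow> 'b::euclidean_space) set" where
  "L2 \<Omega> = {f. f \<in> borel_measurable (lebesgue_on \<Omega>) \<and>
              integrable (lebesgue_on \<Omega>) (\<lambda>x. (norm (f x))\<^sup>2)}"

definition bdot :: "complex^'n::finite \<Rightarrow> complex^'n \<Rightarrow> complex" where
  "bdot v w = (\<Sum>i\<in>UNIV. v $ i * w $ i)"

definition is_weak_div ::
  "(real^'n::finite) set \<Rightarrow> (real^'n \<Rightarrow> complex^'n) \<Rightarrow> (real^'n \<Rightarrow> complex) \<Rightarrow> bool" where
  "is_weak_div \<Omega> J d \<longleftrightarrow>
     (\<forall>\<phi>. test_function \<Omega> \<phi> \<longrightarrow>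
        (LINT x|lebesgue_on \<Omega>. d x * \<phi> x) = - (LINT x|lebesgue_on \<Omega>. bdot (J x) (grad \<phi> x)))"

definition H_div :: "(real^'n::finite) set \<Rightarrow> (real^'n \<Rightarrow> complex^'n) set" where
  "H_div \<Omega> = {J \<in> L2 \<Omega>. \<exists>d \<in> L2 \<Omega>. is_weak_div \<Omega> J d}"

text \<open>For \<open>J\<close> in \<open>H_div \<Omega>\<close>, a representative of the (almost everywhere unique) divergence.\<close>

definition weak_div :: "(real^'n::finite) set \<Rightarrow> (real^'n \<Rightarrow> complex^'n) \<Rightarrow> real^'n \<Rightarrow> complex" where
  "weak_div \<Omega> J = (SOME d. d \<in> L2 \<Omega> \<and> is_weak_div \<Omega> J d)"

text \<open>
  The normal trace \<open>J \<cdot> n\<close> on the boundary of \<open>\<Omega>\<close> is the functional on boundary values given by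
  Green's formula \<open>\<langle>J \<cdot> n, \<phi>\<rangle> = \<integral> J \<cdot> \<nabla>\<phi> + \<integral> (\<nabla> \<cdot> J) \<phi>\<close>. On a ball, where
  the restrictions of globally smooth functions are dense in \<open>H\<^sup>1(\<Omega>)\<close>, it is determined by
  smooth \<open>\<phi>\<close>, which need not vanish on the boundary.
\<close>

definition normal_trace ::
  "(real^'n::finite) set \<Rightarrow> (real^'n \<Rightarrow> complex^'n) \<Rightarrow> (real^'n \<Rightarrow> complex) \<Rightarrow> complex" where
  "normal_trace \<Omega> J \<phi> =
     (LINT x|lebesgue_on \<Omega>. bdot (J x) (grad \<phi> x)) + (LINT x|lebesgue_on \<Omega>. weak_div \<Omega> J x * \<phi> x)"

definition H0_div :: "(real^'n::finite) set \<Rightarrow> (real^'n \<Rightarrow> complex^'n) set" where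
  "H0_div \<Omega> = {J \<in> H_div \<Omega>. \<forall>\<phi>. smooth \<phi> \<longrightarrow> normal_trace \<Omega> J \<phi> = 0}"

text \<open>Essential support in the whole space of the extension by zero of \<open>f\<close> from \<open>\<Omega>\<close>.\<close>

definition ess_support :: "'a::euclidean_space set \<Rightarrow> ('a \<Rightarrow> 'b::zero) \<Rightarrow> 'a set" where
  "ess_support \<Omega> f =
     {x. \<forall>U. open U \<and> x \<in> U \<longrightarrow> \<not> (AE y in lebesgue_on \<Omega>. y \<in> U \<longrightarrow> f y = 0)}"

definition compactly_supported_in :: "('a::euclidean_space \<Rightarrow> 'b::zero) \<Rightarrow> 'a set \<Rightarrow> bool" where
  "compactly_supported_in f \<Omega> \<longleftrightarrow> compact (ess_support \<Omega> f) \<and> ess_support \<Omega> f \<subseteq> \<Omega>"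

section \<open>Electric field and nonradiating sources\<close>

definition green :: "real \<Rightarrow> real^3 \<Rightarrow> real^3 \<Rightarrow> complex" where
  "green \<kappa> x y = exp (\<i> * of_real (\<kappa> * norm (x - y))) / of_real (4 * pi * norm (x - y))"

text \<open>Both derivatives of the Hessian are taken in the first variable; \<open>mat c\<close> is \<open>c\<close> times the
  identity matrix.\<close>

definition green_tensor :: "real \<Rightarrow> real^3 \<Rightarrow> real^3 \<Rightarrow> complex^3^3" where
  "green_tensor \<kappa> x y = mat (green \<kappa> x y) + (1 / \<kappa>\<^sup>2) *\<^sub>R hessian (\<lambda>z. green \<kappa> z y) x"

text \<open>
  The integral is used only at points \<open>x\<close> outside the ball, where it converges absolutely for
  square-integrable \<open>J\<close> compactly supported in the ball. Inside the ball the kernel has a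
  non-integrable singularity and the formula would need a regularised interpretation.
\<close>

definition electric_field :: "real \<Rightarrow> real \<Rightarrow> (real^3 \<Rightarrow> complex^3) \<Rightarrow> real^3 \<Rightarrow> complex^3" where
  "electric_field \<kappa> R J x = (LINT y|lebesgue_on (ball 0 R). green_tensor \<kappa> x y *v J y)"

definition nonradiating :: "real \<Rightarrow> real \<Rightarrow> (real^3 \<Rightarrow> complex^3) \<Rightarrow> bool" where
  "nonradiating \<kappa> R J \<longleftrightarrow>
     compactly_supported_in J (ball 0 R) \<and> (\<forall>x. x \<notin> ball 0 R \<longrightarrow> electric_field \<kappa> R J x = 0)"

section \<open>The null space\<close>

definition spherical_j0 :: "real \<Rightarrow> real" where
  "spherical_j0 t = (if t = 0 then 1 else sin t / t)"

definition null_space2 :: "real \<Rightarrow> real \<Rightarrow> (real^3 \<Rightarrow> complex^3) set" where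
  "null_space2 \<kappa> R = {J \<in> H0_div (ball 0 R).
     \<forall>x. norm x > R \<longrightarrow>
       (LINT y|lebesgue_on (ball 0 R). spherical_j0 (\<kappa> * norm (x - y)) *\<^sub>R J y)
       - (1 / \<kappa>\<^sup>2) *\<^sub>R (LINT y|lebesgue_on (ball 0 R).
            weak_div (ball 0 R) J y *s
            grad (\<lambda>z. complex_of_real (spherical_j0 (\<kappa> * norm (x - z)))) y) = 0}"

end

theory Submission
  imports Defs "HOL-Complex_Analysis.Complex_Analysis" "HOL-Real_Asymp.Real_Asymp"
begin

text \<open>
  The proof continues the fields analytically in the radial variable along each ray.

  Write \<open>E\<^sup>+\<close> for the electric field, whose kernel is the dyad built from
  \<open>exp (\<i> \<kappa> r) / (4 \<pi> r)\<close>, \<open>r = |x - y|\<close>, and \<open>E\<^sup>-\<close> for the incoming field, built in the same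
  way from \<open>exp (- \<i> \<kappa> r) / (4 \<pi> r)\<close>. Since \<open>j\<^sub>0(\<kappa> r)\<close> is a multiple of \<open>sin (\<kappa> r) / r\<close>, and since
  \<open>J\<close> has zero normal trace, integration by parts turns the expression that defines the null space
  into a nonzero multiple of \<open>E\<^sup>+ - E\<^sup>-\<close>. So the claim is that \<open>E\<^sup>+\<close> vanishes outside the ball if
  and only if \<open>E\<^sup>+ = E\<^sup>-\<close> there.

  Fix a unit vector \<open>\<omega>\<close> and put \<open>x = \<omega> / s\<close> with \<open>s > 0\<close>. Then \<open>|x - y| = P / s\<close> with
  \<open>P\<^sup>2 = 1 - 2 s (\<omega> \<bullet> y) + s\<^sup>2 |y|\<^sup>2\<close>. For complex \<open>s\<close> with \<open>|s| |y| < 1\<close> the right-hand side stays off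
  the negative real axis, so its principal root \<open>P\<close> is holomorphic in \<open>s\<close>; so is
  \<open>(P - 1) / s = (s |y|\<^sup>2 - 2 \<omega> \<bullet> y) / (P + 1)\<close>. Hence every component of
  \<open>exp (- \<i> \<kappa> / s) E\<^sup>+(\<omega> / s)\<close> extends to a function \<open>A\<^sub>\<omega>\<close> that is holomorphic in a disc around
  \<open>s = 0\<close>; because the support of \<open>J\<close> lies in a strictly smaller ball, the disc has radius greater
  than \<open>1 / R\<close> (\<open>ray_field\<close>, \<open>holomorphic_on_ray_field\<close>, \<open>electric_field_on_ray\<close>). Replacing
  \<open>(s, \<omega>)\<close> by \<open>(- s, - \<omega>)\<close> leaves \<open>x\<close> and \<open>P\<close> unchanged and reverses the sign of \<open>P / s\<close>, which
  exchanges outgoing and incoming waves: \<open>E\<^sup>-(\<omega> / s) = - exp (- \<i> \<kappa> / s) A\<^sub>-\<^sub>\<omega>(- s)\<close>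
  (\<open>null_space2_expression_on_ray\<close>).

  If \<open>E\<^sup>+\<close> vanishes outside the ball, then all \<open>A\<^sub>\<omega>\<close> vanish on a real interval and therefore
  identically, and the symmetry gives \<open>E\<^sup>- = 0\<close>. Conversely, if \<open>E\<^sup>+ = E\<^sup>-\<close> outside the ball, then
  \<open>exp (2 \<i> \<kappa> / s) A\<^sub>\<omega>(s) = - A\<^sub>-\<^sub>\<omega>(- s)\<close> near \<open>0\<close>. The exponential has an essential singularity at
  \<open>0\<close>: along the positive imaginary axis it grows faster than any power of \<open>1 / |s|\<close>, while the
  right-hand side stays bounded, so \<open>A\<^sub>\<omega>\<close> has a zero of infinite order and vanishes
  (\<open>exp_essential_singularity_imp_zero\<close>). This replaces the usual appeal to Rellich's lemma.
\<close>

unbundle no fps_syntax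

section \<open>Two uniqueness principles for holomorphic functions\<close>

lemma holomorphic_zero_on_real_segment:
  fixes f :: "complex \<Rightarrow> complex" and \<epsilon> :: real
  assumes "f holomorphic_on S" "open S" "connected S" "0 < \<epsilon>"
    and S: "\<And>s. 0 < s \<Longrightarrow> s < \<epsilon> \<Longrightarrow> of_real s \<in> S"
    and zero: "\<And>s. 0 < s \<Longrightarrow> s < \<epsilon> \<Longrightarrow> f (of_real s) = 0"
    and "w \<in> S"
  shows "f w = 0"
proof (rule analytic_continuation[OF assms(1-3)])
  let ?U = "(of_real :: real \<Rightarrow> complex) ` {0<..<\<epsilon>}"
  note \<epsilon> = \<open>0 < \<epsilon>\<close>
  show "?U \<subseteq> S" using S by auto
  show "of_real (\<epsilon>/2) \<in> S" using S[of "\<epsilon>/2"] \<epsilon> by auto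
  show "complex_of_real (\<epsilon>/2) islimpt ?U"
    unfolding islimpt_approachable
  proof (intro allI impI)
    fix e :: real assume e: "e > 0"
    define t where "t = \<epsilon>/2 + min e \<epsilon> / 4"
    have t: "t \<in> {0<..<\<epsilon>}" "t \<noteq> \<epsilon>/2" "dist t (\<epsilon>/2) < e"
      using e \<epsilon> unfolding t_def by (auto simp: dist_real_def min_def)
    have "dist (complex_of_real t) (of_real (\<epsilon>/2)) < e"
      using t(3) by (simp only: dist_of_real)
    then show "\<exists>x'\<in>?U. x' \<noteq> complex_of_real (\<epsilon>/2) \<and> dist x' (complex_of_real (\<epsilon>/2)) < e"
      using t(1,2) by (intro bexI[of _ "complex_of_real t"]) (simp_all only: of_real_eq_iff imageI, simp)
  qed
  show "f u = 0" if "u \<in> ?U" for u using zero that by auto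
  show "w \<in> S" by fact
qed

text \<open>
  A function that is the sum of an outgoing and an incoming expansion in \<open>s = 1 / r\<close> determines both:
  the relation says that \<open>exp (2 \<i> k / s) A(s) + B(s)\<close> vanishes for small real \<open>s\<close>, hence on the
  whole punctured disc. At \<open>s = \<i> t\<close> with \<open>t > 0\<close> the exponential equals \<open>exp (2 k / t)\<close>, so \<open>A\<close>
  tends to zero there faster than any power of \<open>t\<close>, which a nonzero holomorphic function cannot do.
\<close>

lemma exp_essential_singularity_imp_zero:
  fixes A B :: "complex \<Rightarrow> complex" and k \<epsilon> r :: real
  assumes A: "A holomorphic_on ball 0 r" and B: "B holomorphic_on ball 0 r"
    and k: "k > 0" and \<epsilon>: "0 < \<epsilon>" "\<epsilon> \<le> r"
    and rel: "\<And>s. 0 < s \<Longrightarrow> s < \<epsilon> \<Longrightarrow>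
      exp (\<i> * of_real (k / s)) * A (of_real s) + exp (- (\<i> * of_real (k / s))) * B (of_real s) = 0"
    and z: "z \<in> ball 0 r"
  shows "A z = 0"
proof -
  have r: "r > 0" using \<epsilon> by linarith
  define h where "h = (\<lambda>s. exp (2 * \<i> * of_real k / s) * A s + B s)"
  have hol: "h holomorphic_on ball 0 r - {0}"
    unfolding h_def by (intro holomorphic_intros holomorphic_on_subset[OF A] holomorphic_on_subset[OF B]) auto
  have h0: "h w = 0" if w: "w \<in> ball 0 r - {0}" for w
  proof (rule holomorphic_zero_on_real_segment[OF hol _ _ \<epsilon>(1) _ _ w])
    show "open (ball (0::complex) r - {0})" by auto
    show "connected (ball (0::complex) r - {0})" by (rule connected_punctured_ball) simp
    fix s :: real assume s: "0 < s" "s < \<epsilon>"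
    then show "complex_of_real s \<in> ball 0 r - {0}" using \<epsilon> by auto
    have "h (of_real s) = exp (\<i> * of_real (k / s)) *
        (exp (\<i> * of_real (k / s)) * A (of_real s) + exp (- (\<i> * of_real (k / s))) * B (of_real s))"
      unfolding h_def distrib_left mult.assoc[symmetric] exp_add[symmetric]
      by (simp add: mult.assoc)
    then show "h (of_real s) = 0" using rel[OF s] by simp
  qed
  show ?thesis
  proof (rule ccontr)
    assume Az: "A z \<noteq> 0"
    obtain g q n where gq: "0 < q" "\<And>w. w \<in> ball 0 q \<Longrightarrow> A w = w ^ n * g w" "g holomorphic_on ball 0 q" "g 0 \<noteq> 0" "ball 0 q \<subseteq> ball (0::complex) r"
    proof (cases "A 0 = 0")
      case False
      then show ?thesis using that[of r 0 A] A r by auto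
    next
      case True
      have nc: "\<not> A constant_on ball 0 r"
        using Az True z r unfolding constant_on_def by force
      show ?thesis
        by (rule holomorphic_factor_zero_nonconstant[OF A open_ball connected_ball _ True nc])
           (use r that in \<open>auto\<close>)
    qed
    \<comment> \<open>On the positive imaginary axis the exponential is real and large.\<close>
    have gB: "norm (g (\<i> * of_real t)) = norm (B (\<i> * of_real t)) * (exp (- (2 * k / t)) / t ^ n)" if t: "0 < t" "t < q" for t
    proof -
      let ?s = "\<i> * complex_of_real t"
      have m: "?s \<in> ball 0 q" using t by (simp add: norm_mult)
      then have m2: "?s \<in> ball 0 r - {0}" using t gq(5) by auto
      have e: "2 * \<i> * of_real k / ?s = of_real (2 * k / t)" using t by (simp add: field_simps)
      have "exp (of_real (2 * k / t)) * (?s ^ n * g ?s) = - B ?s"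
        using h0[OF m2] gq(2)[OF m] unfolding h_def e by (simp add: eq_neg_iff_add_eq_0)
      then have "norm (exp (complex_of_real (2 * k / t)) * (?s ^ n * g ?s)) = norm (B ?s)" by simp
      then have "exp (2 * k / t) * t ^ n * norm (g ?s) = norm (B ?s)"
        using t by (simp add: norm_mult norm_power)
      then show ?thesis using t by (simp add: exp_minus field_simps)
    qed
    have cont0: "((\<lambda>t. f (\<i> * complex_of_real t)) \<longlongrightarrow> f 0) (at_right 0)" if "f holomorphic_on ball 0 e" "e > 0" for f :: "complex \<Rightarrow> complex" and e
    proof -
      have "isCont f 0" using that by (meson centre_in_ball continuous_on_interior holomorphic_on_imp_continuous_on interior_open open_ball continuous_on_eq_continuous_at)
      moreover have "((\<lambda>t. \<i> * complex_of_real t) \<longlongrightarrow> 0) (at_right 0)"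
        by (auto intro!: tendsto_eq_intros)
      ultimately show ?thesis by (rule isCont_tendsto_compose)
    qed
    have "((\<lambda>t. exp (- (2 * k / t)) / t ^ n) \<longlongrightarrow> 0) (at_right 0)"
      using k by real_asymp
    then have "((\<lambda>t. norm (B (\<i> * of_real t)) * (exp (- (2 * k / t)) / t ^ n)) \<longlongrightarrow> norm (B 0) * 0) (at_right 0)"
      by (intro tendsto_intros cont0[OF B r])
    moreover have "eventually (\<lambda>t. norm (B (\<i> * of_real t)) * (exp (- (2 * k / t)) / t ^ n) = norm (g (\<i> * of_real t))) (at_right 0)"
      using eventually_at_right_less[of "0::real"] eventually_at_right_real[OF gq(1)] by eventually_elim (use gB in auto)
    ultimately have "((\<lambda>t. norm (g (\<i> * of_real t))) \<longlongrightarrow> 0) (at_right 0)"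
      by (simp add: Lim_transform_eventually)
    moreover have "((\<lambda>t. norm (g (\<i> * of_real t))) \<longlongrightarrow> norm (g 0)) (at_right 0)"
      by (intro tendsto_intros cont0[OF gq(3,1)])
    ultimately have "norm (g 0) = 0" using tendsto_unique trivial_limit_at_right_real by blast
    then show False using gq(4) by simp
  qed
qed

section \<open>Integrals and integrability\<close>

lemma integrable_bounded_mult:
  fixes f w :: "'a \<Rightarrow> complex"
  assumes w: "integrable M w" and f: "f \<in> borel_measurable M"
    and B: "\<And>y. y \<in> space M \<Longrightarrow> norm (f y) \<le> B"
  shows "integrable M (\<lambda>y. f y * w y)"
proof (rule Bochner_Integration.integrable_bound[of _ "\<lambda>y. of_real \<bar>B\<bar> * w y"])
  show "integrable M (\<lambda>y. of_real \<bar>B\<bar> * w y)" using w by simp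
  show "(\<lambda>y. f y * w y) \<in> borel_measurable M"
    using f borel_measurable_integrable[OF w] by (rule borel_measurable_times)
  show "AE y in M. norm (f y * w y) \<le> norm (complex_of_real \<bar>B\<bar> * w y)"
    using B by (intro AE_I2) (force simp: norm_mult intro!: mult_right_mono)
qed

text \<open>
  Only measurability in \<open>y\<close> is available for the weight, so differentiation under the integral
  sign goes through dominated convergence: on a small disc Cauchy's inequality turns the
  uniform bound on \<open>f\<close> into a uniform bound on its difference quotients in \<open>s\<close>.
\<close>

lemma holomorphic_parameter_integral:
  fixes f :: "complex \<Rightarrow> 'a \<Rightarrow> complex" and w :: "'a \<Rightarrow> complex"
  assumes U: "open U"
    and hol: "\<And>y. y \<in> space M \<Longrightarrow> (\<lambda>s. f s y) holomorphic_on U"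
    and bound: "\<And>s y. s \<in> U \<Longrightarrow> y \<in> space M \<Longrightarrow> norm (f s y) \<le> B"
    and meas: "\<And>s. s \<in> U \<Longrightarrow> f s \<in> borel_measurable M"
    and w: "integrable M w"
  shows "(\<lambda>s. LINT y|M. f s y * w y) holomorphic_on U"
proof -
  have int: "integrable M (\<lambda>y. f s y * w y)" if "s \<in> U" for s
    using integrable_bounded_mult[OF w meas[OF that]] bound[OF that] by blast
  have "(\<lambda>s. LINT y|M. f s y * w y) field_differentiable (at s0)" if s0: "s0 \<in> U" for s0
  proof -
    obtain e where e: "e > 0" "cball s0 e \<subseteq> U" using U s0 open_contains_cball by blast
    \<comment> \<open>Half the radius, so that discs of radius r around points of the disc stay in U.\<close>
    define r where "r = e / 2"
    have r: "r > 0" "ball s0 r \<subseteq> U" "s0 \<in> ball s0 r" using e unfolding r_def by (auto simp: subset_iff)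
    have lip: "norm (f s y - f s0 y) \<le> B / r * norm (s - s0)" if "s \<in> ball s0 r" "y \<in> space M" for s y
    proof (rule field_differentiable_bound[of "ball s0 r" "\<lambda>s. f s y" "\<lambda>s. deriv (\<lambda>s. f s y) s"])
      fix z assume z: "z \<in> ball s0 r"
      have zU: "cball z r \<subseteq> U"
      proof
        fix x assume "x \<in> cball z r"
        then have "dist s0 x \<le> e" using z dist_triangle[of s0 x z] unfolding r_def by auto
        then show "x \<in> U" using e by auto
      qed
      have hU: "(\<lambda>s. f s y) holomorphic_on U" using hol that by auto
      have zz: "z \<in> U" using zU r by auto
      show "((\<lambda>s. f s y) has_field_derivative deriv (\<lambda>s. f s y) z) (at z within ball s0 r)"
        using hU zz U by (meson has_field_derivative_at_within holomorphic_derivI)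
      have "norm ((deriv ^^ 1) (\<lambda>s. f s y) z) \<le> fact 1 * B / r ^ 1"
        by (rule Cauchy_inequality)
           (use zU hU r that bound in \<open>auto intro!: holomorphic_on_subset[OF hU] continuous_on_subset[OF holomorphic_on_imp_continuous_on[OF hU]] simp: subset_iff dist_norm\<close>)
      then show "norm (deriv (\<lambda>s. f s y) z) \<le> B / r" by simp
    qed (use that r in auto)
    have "((\<lambda>s. ((LINT y|M. f s y * w y) - (LINT y|M. f s0 y * w y)) / (s - s0)) \<longlongrightarrow> (LINT y|M. deriv (\<lambda>s. f s y) s0 * w y)) (at s0 within ball s0 r)"
      unfolding tendsto_at_iff_sequentially o_def
    proof (intro allI impI)
      fix X assume X: "\<forall>i. X i \<in> ball s0 r - {s0}" "X \<longlonglongrightarrow> s0"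
      have XU: "X i \<in> U" for i using X r by auto
      have dq: "(\<lambda>i. (f (X i) y - f s0 y) / (X i - s0)) \<longlonglongrightarrow> deriv (\<lambda>s. f s y) s0" if "y \<in> space M" for y
      proof -
        have "((\<lambda>s. f s y) has_field_derivative deriv (\<lambda>s. f s y) s0) (at s0 within ball s0 r)"
          using hol[OF that] s0 U by (meson has_field_derivative_at_within holomorphic_derivI)
        then show ?thesis unfolding has_field_derivative_iff tendsto_at_iff_sequentially o_def using X by blast
      qed
      have eq: "((LINT y|M. f (X i) y * w y) - (LINT y|M. f s0 y * w y)) / (X i - s0) = (LINT y|M. (f (X i) y - f s0 y) / (X i - s0) * w y)" for i
        by (simp add: Bochner_Integration.integral_diff[OF int[OF XU] int[OF s0], symmetric] left_diff_distrib flip: integral_divide_zero)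
      show "(\<lambda>i. ((LINT y|M. f (X i) y * w y) - (LINT y|M. f s0 y * w y)) / (X i - s0)) \<longlonglongrightarrow> (LINT y|M. deriv (\<lambda>s. f s y) s0 * w y)"
        unfolding eq
      proof (rule integral_dominated_convergence[where w = "\<lambda>y. B / r * norm (w y)"])
        have m: "(\<lambda>y. (f (X i) y - f s0 y) / (X i - s0)) \<in> borel_measurable M" for i
          using meas[OF XU] meas[OF s0] by measurable
        show "(\<lambda>y. (f (X i) y - f s0 y) / (X i - s0) * w y) \<in> borel_measurable M" for i
          using m borel_measurable_integrable[OF w] by (rule borel_measurable_times)
        have "(\<lambda>y. deriv (\<lambda>s. f s y) s0) \<in> borel_measurable M"
          using m dq by (rule borel_measurable_LIMSEQ_metric)
        then show "(\<lambda>y. deriv (\<lambda>s. f s y) s0 * w y) \<in> borel_measurable M"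
          using borel_measurable_integrable[OF w] by (rule borel_measurable_times)
        show "integrable M (\<lambda>y. B / r * norm (w y))" using w by simp
        show "AE y in M. (\<lambda>i. (f (X i) y - f s0 y) / (X i - s0) * w y) \<longlonglongrightarrow> deriv (\<lambda>s. f s y) s0 * w y"
          using dq by (intro AE_I2 tendsto_mult) auto
        show "AE y in M. norm ((f (X i) y - f s0 y) / (X i - s0) * w y) \<le> B / r * norm (w y)" for i
        proof (rule AE_I2)
          fix y assume y: "y \<in> space M"
          have "X i \<in> ball s0 r" "X i \<noteq> s0" using X by auto
          then have "norm ((f (X i) y - f s0 y) / (X i - s0)) \<le> B / r"
            using lip[of "X i" y] y by (simp add: norm_divide divide_le_eq)
          then show "norm ((f (X i) y - f s0 y) / (X i - s0) * w y) \<le> B / r * norm (w y)"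
            unfolding norm_mult by (rule mult_right_mono) simp
        qed
      qed
    qed
    then have "((\<lambda>s. LINT y|M. f s y * w y) has_field_derivative (LINT y|M. deriv (\<lambda>s. f s y) s0 * w y)) (at s0 within ball s0 r)"
      by (simp add: has_field_derivative_iff)
    then show ?thesis
      using at_within_open[OF r(3) open_ball] unfolding field_differentiable_def by metis
  qed
  then show ?thesis
    unfolding holomorphic_on_def by (blast intro: field_differentiable_at_within)
qed

text \<open>
  The complement of the essential support is a union of open sets on each of which \<open>f\<close> vanishes
  almost everywhere; by Lindelof's theorem countably many of them suffice.
\<close>

lemma ess_support_AE_zero:
  fixes f :: "'a::euclidean_space \<Rightarrow> 'b::zero"
  shows "AE y in lebesgue_on \<Omega>. y \<notin> ess_support \<Omega> f \<longrightarrow> f y = 0"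
proof -
  define \<U> where "\<U> = {U. open U \<and> (AE y in lebesgue_on \<Omega>. y \<in> U \<longrightarrow> f y = 0)}"
  have cover: "- ess_support \<Omega> f = \<Union>\<U>"
    unfolding ess_support_def \<U>_def by auto
  obtain \<V> where V: "\<V> \<subseteq> \<U>" "countable \<V>" "\<Union>\<V> = \<Union>\<U>"
    by (rule Lindelof[of \<U>]) (auto simp: \<U>_def)
  have "AE y in lebesgue_on \<Omega>. \<forall>U\<in>\<V>. y \<in> U \<longrightarrow> f y = 0"
    using V(1) unfolding AE_ball_countable[OF V(2)] \<U>_def by blast
  then show ?thesis
  proof eventually_elim
    case (elim y)
    then show ?case using cover V(3) by blast
  qed
qed

lemma compactly_supported_in_ballE:
  fixes f :: "'a::euclidean_space \<Rightarrow> 'b::zero"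
  assumes "compactly_supported_in f (ball 0 R)" "R > 0"
  obtains \<rho> where "0 < \<rho>" "\<rho> < R" "AE y in lebesgue_on (ball 0 R). norm y > \<rho> \<longrightarrow> f y = 0"
proof -
  let ?K = "ess_support (ball 0 R) f"
  have K: "compact ?K" "?K \<subseteq> ball 0 R" using assms(1) unfolding compactly_supported_in_def by auto
  obtain \<rho> where \<rho>: "0 < \<rho>" "\<rho> < R" "\<And>y. y \<in> ?K \<Longrightarrow> norm y \<le> \<rho>"
  proof (cases "?K = {}")
    case True
    then show ?thesis using that[of "R/2"] assms(2) by auto
  next
    case False
    obtain a where a: "a \<in> ?K" "\<And>y. y \<in> ?K \<Longrightarrow> norm y \<le> norm a"
      using continuous_attains_sup[OF K(1) False, of norm] continuous_on_norm_id by blast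
    have "norm a < R" using a(1) K(2) by auto
    then show ?thesis using that[of "max (norm a) (R/2)"] a(2) assms(2) by force
  qed
  show ?thesis
  proof (rule that[OF \<rho>(1,2)])
    show "AE y in lebesgue_on (ball 0 R). norm y > \<rho> \<longrightarrow> f y = 0"
      using ess_support_AE_zero[of "ball 0 R" f] by eventually_elim (use \<rho>(3) in force)
  qed
qed

lemma L2_ball_integrable:
  fixes f :: "'a::euclidean_space \<Rightarrow> 'b::euclidean_space"
  assumes "f \<in> L2 (ball 0 R)"
  shows "integrable (lebesgue_on (ball 0 R)) f"
proof -
  let ?M = "lebesgue_on (ball (0::'a) R)"
  have m: "f \<in> borel_measurable ?M" and i: "integrable ?M (\<lambda>x. (norm (f x))\<^sup>2)"
    using assms unfolding L2_def by auto
  have c: "integrable ?M (\<lambda>x. 1 :: real)"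
    by (rule finite_measure.integrable_const) (use emeasure_bounded_finite[OF bounded_ball, of "0::'a" R] in
        \<open>auto intro!: finite_measureI simp: emeasure_restrict_space\<close>)
  show ?thesis
  proof (rule Bochner_Integration.integrable_bound[of _ "\<lambda>x. 1 + (norm (f x))\<^sup>2"])
    show "integrable ?M (\<lambda>x. 1 + (norm (f x))\<^sup>2)" using c i by (rule Bochner_Integration.integrable_add)
    have "t \<le> 1 + t\<^sup>2" for t :: real
      using zero_le_power2[of "t - 1/2"] by (simp add: power2_eq_square algebra_simps)
    then show "AE x in ?M. norm (f x) \<le> norm (1 + (norm (f x))\<^sup>2)" by (intro AE_I2) simp
  qed (rule m)
qed

text \<open>
  Continuity on the whole space makes \<open>f\<close> bounded on the closed ball.
\<close>

lemma integrable_continuous_mult: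
  fixes f w :: "'a::euclidean_space \<Rightarrow> complex"
  assumes w: "integrable (lebesgue_on (ball 0 R)) w" and f: "continuous_on UNIV f"
  shows "integrable (lebesgue_on (ball 0 R)) (\<lambda>y. f y * w y)"
proof -
  have "compact (f ` cball 0 R)"
    by (rule compact_continuous_image[OF continuous_on_subset[OF f]]) auto
  then obtain B where B: "\<And>y. y \<in> cball 0 R \<Longrightarrow> norm (f y) \<le> B"
    using compact_imp_bounded bounded_iff by (metis imageI)
  show ?thesis
  proof (rule integrable_bounded_mult[OF w, of _ B])
    show "f \<in> borel_measurable (lebesgue_on (ball 0 R))"
      by (rule continuous_imp_measurable_on_sets_lebesgue[OF continuous_on_subset[OF f]]) auto
    show "norm (f y) \<le> B" if "y \<in> space (lebesgue_on (ball 0 R))" for y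
      using B[of y] that by auto
  qed
qed

lemma integrable_vec:
  fixes f :: "'a \<Rightarrow> complex^'n::finite"
  assumes "\<And>i. integrable M (\<lambda>x. f x $ i)"
  shows "integrable M f"
proof -
  have b: "bounded_linear (\<lambda>c :: complex. axis i c :: complex^'n)" for i
    unfolding linear_conv_bounded_linear[symmetric]
    by (rule linearI) (auto simp: axis_def vec_eq_iff)
  have "integrable M (\<lambda>x. \<Sum>i\<in>UNIV. axis i (f x $ i) :: complex^'n)"
    by (intro Bochner_Integration.integrable_sum integrable_bounded_linear[OF b] assms)
  moreover have "(\<Sum>i\<in>UNIV. axis i (v $ i)) = v" for v :: "complex^'n"
    by (simp add: vec_eq_iff axis_def)
  ultimately show ?thesis by simp
qed

lemma integral_vec_nth:
  fixes f :: "'a \<Rightarrow> complex^'n::finite"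
  assumes "integrable M f"
  shows "(LINT x|M. f x) $ i = (LINT x|M. f x $ i)"
  using integral_bounded_linear[OF bounded_linear_vec_nth assms] by metis

section \<open>Derivatives of radial functions\<close>

lemma partial_eqI: "(f has_derivative f') (at x) \<Longrightarrow> partial i f x = f' (axis i 1)"
  unfolding partial_def using frechet_derivative_at by metis

lemma partial_transform:
  assumes "open S" "x \<in> S" "\<And>z. z \<in> S \<Longrightarrow> f z = g z"
  shows "partial i f x = partial i g x"
proof -
  have "(f has_derivative D) (at x) \<longleftrightarrow> (g has_derivative D) (at x)" for D
    using has_derivative_transform_within_open[OF _ assms(1,2), of f D UNIV g]
      has_derivative_transform_within_open[OF _ assms(1,2), of g D UNIV f] assms(3) by auto
  then show ?thesis unfolding partial_def frechet_derivative_def by simp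
qed

text \<open>
  Formulas for radial functions fail at the centre, so second derivatives are compared on an open
  set that avoids it.
\<close>

lemma hessian_transform:
  assumes "open S" "x \<in> S" "\<And>z. z \<in> S \<Longrightarrow> f z = g z"
  shows "partial i (partial j f) x = partial i (partial j g) x"
  by (rule partial_transform[OF assms(1,2)]) (rule partial_transform[OF assms(1) _ assms(3)])

lemma has_derivative_norm_diff:
  fixes x p :: "'a::real_inner"
  assumes "x \<noteq> p"
  shows "((\<lambda>z. norm (z - p)) has_derivative (\<lambda>v. (x - p) \<bullet> v / norm (x - p))) (at x)"
proof -
  have "((\<lambda>z. norm (z - p)) has_derivative (\<lambda>v. v \<bullet> sgn (x - p))) (at x)"
    by (rule has_derivative_compose[OF _ has_derivative_norm])
      (use assms in \<open>auto intro!: derivative_eq_intros\<close>)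
  then show ?thesis by (simp add: sgn_div_norm inner_commute divide_inverse mult.commute)
qed

lemma has_derivative_radial:
  fixes h h1 :: "real \<Rightarrow> complex" and x p :: "real^'n::finite"
  assumes "x \<noteq> p" "\<And>r. r > 0 \<Longrightarrow> (h has_vector_derivative h1 r) (at r)"
  shows "((\<lambda>z. h (norm (z - p))) has_derivative
     (\<lambda>v. ((x - p) \<bullet> v / norm (x - p)) *\<^sub>R h1 (norm (x - p)))) (at x)"
proof -
  have "norm (x - p) > 0" using assms by simp
  from assms(2)[OF this] have "(h has_derivative (\<lambda>t. t *\<^sub>R h1 (norm (x - p)))) (at (norm (x - p)))"
    unfolding has_vector_derivative_def .
  from has_derivative_compose[OF has_derivative_norm_diff[OF assms(1)] this]
  show ?thesis .
qed

lemma partial_radial: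
  fixes h h1 :: "real \<Rightarrow> complex" and x p :: "real^'n::finite"
  assumes "x \<noteq> p" "\<And>r. r > 0 \<Longrightarrow> (h has_vector_derivative h1 r) (at r)"
  shows "partial i (\<lambda>z. h (norm (z - p))) x = ((x - p) $ i / norm (x - p)) *\<^sub>R h1 (norm (x - p))"
  using partial_eqI[OF has_derivative_radial[OF assms], of i] by (simp add: inner_axis)

text \<open>
  The first derivatives are \<open>(z - p)\<^sub>j g(|z - p|)\<close> with \<open>g = h' / r\<close>; the second derivatives follow by the
  product rule with \<open>g' = (h'' - h' / r) / r\<close>.
\<close>

lemma hessian_radial:
  fixes h h1 h2 :: "real \<Rightarrow> complex" and x p :: "real^'n::finite"
  assumes xp: "x \<noteq> p"
    and h1: "\<And>r. r > 0 \<Longrightarrow> (h has_vector_derivative h1 r) (at r)"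
    and h2: "\<And>r. r > 0 \<Longrightarrow> (h1 has_vector_derivative h2 r) (at r)"
  shows "partial i (partial j (\<lambda>z. h (norm (z - p)))) x =
     (if i = j then h1 (norm (x - p)) / of_real (norm (x - p)) else 0) +
     of_real ((x - p) $ i * (x - p) $ j) / (of_real (norm (x - p)))\<^sup>2 *
       (h2 (norm (x - p)) - h1 (norm (x - p)) / of_real (norm (x - p)))"
proof -
  define g where "g = (\<lambda>r. h1 r / of_real r)"
  have g': "(g has_vector_derivative (h2 r - h1 r / of_real r) / of_real r) (at r)" if "r > 0" for r
  proof -
    have "((\<lambda>r. inverse r *\<^sub>R h1 r) has_vector_derivative inverse r *\<^sub>R h2 r + (- inverse (r\<^sup>2)) *\<^sub>R h1 r) (at r)"
      using that h2[OF that]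
      by (intro has_vector_derivative_scaleR) (auto intro!: derivative_eq_intros simp: power2_eq_square)
    also have "inverse r *\<^sub>R h2 r + (- inverse (r\<^sup>2)) *\<^sub>R h1 r = (h2 r - h1 r / of_real r) / of_real r"
      using that by (simp add: scaleR_conv_of_real field_simps power2_eq_square)
    also have "(\<lambda>r. inverse r *\<^sub>R h1 r) = g"
      by (auto simp: g_def scaleR_conv_of_real divide_inverse)
    finally show ?thesis .
  qed
  have "partial i (partial j (\<lambda>z. h (norm (z - p)))) x = partial i (\<lambda>z. (z - p) $ j *\<^sub>R g (norm (z - p))) x"
    by (rule partial_transform[of "- {p}"])
       (use xp in \<open>auto simp: partial_radial[OF _ h1] g_def scaleR_conv_of_real\<close>)
  also have "\<dots> = (axis i 1 $ j) *\<^sub>R g (norm (x - p)) +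
      (x - p) $ j *\<^sub>R (((x - p) \<bullet> axis i 1 / norm (x - p)) *\<^sub>R ((h2 (norm (x - p)) - h1 (norm (x - p)) / of_real (norm (x - p))) / of_real (norm (x - p))))"
  proof -
    have c: "((\<lambda>z. (z - p) $ j) has_derivative (\<lambda>v. v $ j)) (at x)"
      by (auto intro!: derivative_eq_intros bounded_linear.has_derivative[OF bounded_linear_vec_nth])
    show ?thesis
      using partial_eqI[OF has_derivative_scaleR[OF c has_derivative_radial[OF xp g']], of i]
      by (simp add: add.commute)
  qed
  also have "\<dots> = (if i = j then h1 (norm (x - p)) / of_real (norm (x - p)) else 0) +
     of_real ((x - p) $ i * (x - p) $ j) / (of_real (norm (x - p)))\<^sup>2 *
       (h2 (norm (x - p)) - h1 (norm (x - p)) / of_real (norm (x - p)))"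
  proof -
    have "axis i (1::real) $ j = (if i = j then 1 else 0)" by (simp add: axis_def)
    then show ?thesis by (simp add: inner_axis g_def scaleR_conv_of_real power2_eq_square)
  qed
  finally show ?thesis .
qed

section \<open>Smoothness of the spherical Bessel kernel\<close>

text \<open>
  Testing the normal trace needs functions that are smooth on all of space, including the centre
  \<open>p\<close>, where \<open>|z - p|\<close> is not differentiable. Given functions \<open>F m\<close> on the line with
  \<open>(F m)' = F (m + 1)\<close>, the algebra generated by constants, coordinates and \<open>F m (|z - p|\<^sup>2)\<close> is closed
  under partial derivatives, because \<open>|z - p|\<^sup>2\<close> is a polynomial. Hence all its members are smooth.
\<close>

inductive_set entire_radial_algebra :: "(nat \<Rightarrow> real \<Rightarrow> real) \<Rightarrow> real^'n::finite \<Rightarrow> (real^'n \<Rightarrow> complex) set"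
  for F :: "nat \<Rightarrow> real \<Rightarrow> real" and p :: "real^'n" where
  const: "(\<lambda>z. c) \<in> entire_radial_algebra F p"
| coord: "(\<lambda>z. of_real ((z - p) $ i)) \<in> entire_radial_algebra F p"
| radial: "(\<lambda>z. of_real (F m ((norm (z - p))\<^sup>2))) \<in> entire_radial_algebra F p"
| add: "f \<in> entire_radial_algebra F p \<Longrightarrow> g \<in> entire_radial_algebra F p \<Longrightarrow> (\<lambda>z. f z + g z) \<in> entire_radial_algebra F p"
| mult: "f \<in> entire_radial_algebra F p \<Longrightarrow> g \<in> entire_radial_algebra F p \<Longrightarrow> (\<lambda>z. f z * g z) \<in> entire_radial_algebra F p"

lemma entire_radial_algebra_derivative:
  fixes p :: "real^'n::finite"
  assumes F: "\<And>m t. (F m has_real_derivative F (Suc m) t) (at t)"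
    and f: "f \<in> entire_radial_algebra F p"
  shows "f differentiable (at x)" "partial i f \<in> entire_radial_algebra F p"
proof -
  have "(\<forall>x. f differentiable (at x)) \<and> (\<forall>i. partial i f \<in> entire_radial_algebra F p)"
    using f
  proof induction
    case (const c)
    have d: "((\<lambda>z. c) has_derivative (\<lambda>v. 0)) (at x)" for x :: "real^'n" by simp
    have "partial i (\<lambda>z :: real^'n. c) = (\<lambda>z. 0)" for i
      using partial_eqI[OF d] by auto
    then show ?case
      using d entire_radial_algebra.const[of 0 F p] by (auto intro: differentiableI)
  next
    case (coord j)
    have d: "((\<lambda>z. complex_of_real ((z - p) $ j)) has_derivative (\<lambda>v. of_real (v $ j))) (at x)" for x
      by (auto intro!: derivative_eq_intros bounded_linear.has_derivative[OF bounded_linear_vec_nth] has_derivative_of_real)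
    have "partial i (\<lambda>z. complex_of_real ((z - p) $ j)) = (\<lambda>z. of_real (axis i 1 $ j))" for i
      using partial_eqI[OF d] by auto
    then show ?case using d entire_radial_algebra.const by (auto intro: differentiableI)
  next
    case (radial m)
    have d: "((\<lambda>z. complex_of_real (F m ((norm (z - p))\<^sup>2))) has_derivative
        (\<lambda>v. of_real (2 * ((x - p) \<bullet> v) * F (Suc m) ((norm (x - p))\<^sup>2)))) (at x)" for x
    proof -
      have "((\<lambda>z. (z - p) \<bullet> (z - p)) has_derivative (\<lambda>v. 2 * ((x - p) \<bullet> v))) (at x)"
        by (auto intro!: derivative_eq_intros simp: inner_commute)
      then have q: "((\<lambda>z. (norm (z - p))\<^sup>2) has_derivative (\<lambda>v. 2 * ((x - p) \<bullet> v))) (at x)"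
        by (simp only: power2_norm_eq_inner)
      have "((\<lambda>z. F m ((norm (z - p))\<^sup>2)) has_derivative (\<lambda>v. 2 * ((x - p) \<bullet> v) * F (Suc m) ((norm (x - p))\<^sup>2))) (at x)"
        using has_derivative_compose[OF q F[unfolded has_field_derivative_def]] by (simp only: mult.commute)
      then show ?thesis by (rule has_derivative_of_real)
    qed
    have "partial i (\<lambda>z. complex_of_real (F m ((norm (z - p))\<^sup>2))) =
       (\<lambda>z. (2 * of_real ((z - p) $ i)) * of_real (F (Suc m) ((norm (z - p))\<^sup>2)))" for i
      using partial_eqI[OF d] by (auto simp: inner_axis)
    then have "partial i (\<lambda>z. complex_of_real (F m ((norm (z - p))\<^sup>2))) \<in> entire_radial_algebra F p" for i
      by (simp only:) (intro entire_radial_algebra.intros)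
    then show ?case using d by (blast intro: differentiableI)
  next
    case (add f g)
    have d: "((\<lambda>z. f z + g z) has_derivative (\<lambda>v. frechet_derivative f (at x) v + frechet_derivative g (at x) v)) (at x)" for x
      using add.IH by (intro has_derivative_add) (auto simp flip: frechet_derivative_works)
    have "partial i (\<lambda>z. f z + g z) = (\<lambda>z. partial i f z + partial i g z)" for i
      using partial_eqI[OF d] by (auto simp: partial_def)
    moreover have "(\<lambda>z. partial i f z + partial i g z) \<in> entire_radial_algebra F p" for i
      using add.IH by (intro entire_radial_algebra.add) auto
    ultimately show ?case using d by (auto intro: differentiableI)
  next
    case (mult f g)
    have d: "((\<lambda>z. f z * g z) has_derivative (\<lambda>v. f x * frechet_derivative g (at x) v + frechet_derivative f (at x) v * g x)) (at x)" for x
      using mult.IH by (intro has_derivative_mult) (auto simp flip: frechet_derivative_works)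
    have "partial i (\<lambda>z. f z * g z) = (\<lambda>z. f z * partial i g z + partial i f z * g z)" for i
      using partial_eqI[OF d] by (auto simp: partial_def)
    moreover have "(\<lambda>z. f z * partial i g z + partial i f z * g z) \<in> entire_radial_algebra F p" for i
      using mult.IH mult.hyps by (intro entire_radial_algebra.add entire_radial_algebra.mult) auto
    ultimately show ?case using d by (auto intro: differentiableI)
  qed
  then show "f differentiable (at x)" "partial i f \<in> entire_radial_algebra F p" by auto
qed

lemma smooth_entire_radial_algebra:
  assumes F: "\<And>m t. (F m has_real_derivative F (Suc m) t) (at t)"
    and "f \<in> entire_radial_algebra F p"
  shows "smooth f"
proof -
  have "Ck k f" for k using assms(2)
  proof (induction k arbitrary: f)
    case 0
    have "\<And>x. isCont f x"
      using entire_radial_algebra_derivative(1)[where F = F, OF F 0] differentiable_imp_continuous_within by blast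
    then show ?case by (simp add: continuous_at_imp_continuous_on)
  next
    case (Suc k)
    show ?case
      using entire_radial_algebra_derivative[where F = F, OF F Suc.prems] Suc.IH by simp
  qed
  then show ?thesis unfolding smooth_def by simp
qed

text \<open>
  The Taylor series of \<open>sin t / t\<close> contains only even powers, so \<open>j\<^sub>0(\<kappa> r)\<close> is an everywhere
  convergent power series in \<open>r\<^sup>2\<close>; the functions \<open>F m\<close> are its termwise derivatives.
\<close>

lemma spherical_j0_entire:
  obtains F :: "nat \<Rightarrow> real \<Rightarrow> real" where "\<And>m t. (F m has_real_derivative F (Suc m) t) (at t)"
    "\<And>r. F 0 (r\<^sup>2) = spherical_j0 (\<kappa> * r)"
proof
  define c where "c = (\<lambda>n. (- 1) ^ n * \<kappa> ^ (2 * n) / fact (2 * n + 1) :: real)"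
  define F where "F = (\<lambda>m t. \<Sum>n. (diffs ^^ m) c n * t ^ n :: real)"
  have s: "(\<lambda>n. c n * (r\<^sup>2) ^ n) sums spherical_j0 (\<kappa> * r)" for r
  proof (cases "\<kappa> * r = 0")
    case True
    have "(\<lambda>n. c n * (r\<^sup>2) ^ n) = (\<lambda>n. if n = 0 then 1 else 0)"
      using True by (auto simp: c_def fun_eq_iff)
    then show ?thesis using sums_single[of 0 "\<lambda>_. 1 :: real"] True unfolding spherical_j0_def by simp
  next
    case False
    have "(\<lambda>n. (- 1) ^ n / fact (2 * n + 1) * (\<kappa> * r) ^ (2 * n + 1) / (\<kappa> * r)) sums (sin (\<kappa> * r) / (\<kappa> * r))"
      by (intro sums_divide sin_paired)
    also have "(\<lambda>n. (- 1) ^ n / fact (2 * n + 1) * (\<kappa> * r) ^ (2 * n + 1) / (\<kappa> * r)) = (\<lambda>n. c n * (r\<^sup>2) ^ n)"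
      using False by (auto simp: c_def fun_eq_iff power_mult_distrib power_mult)
    finally show ?thesis using False unfolding spherical_j0_def by simp
  qed
  have summ0: "summable (\<lambda>n. c n * t ^ n)" for t
  proof (rule powser_inside)
    \<comment> \<open>The series is known to converge only at squares, so any square larger than \<open>|t|\<close> is taken.\<close>
    show "summable (\<lambda>n. c n * ((sqrt (\<bar>t\<bar> + 1))\<^sup>2) ^ n)" using s by (rule sums_summable)
    show "norm t < norm ((sqrt (\<bar>t\<bar> + 1))\<^sup>2)" by simp
  qed
  have summ: "summable (\<lambda>n. (diffs ^^ m) c n * t ^ n)" for m t
  proof (induction m arbitrary: t)
    case 0
    then show ?case using summ0 by simp
  next
    case (Suc m)
    show ?case using termdiff_converges_all[OF Suc.IH] by simp
  qed
  show "(F m has_real_derivative F (Suc m) t) (at t)" for m t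
    unfolding F_def using termdiffs_strong_converges_everywhere[OF summ] by simp
  show "F 0 (r\<^sup>2) = spherical_j0 (\<kappa> * r)" for r
    unfolding F_def using s[of r] by (simp add: sums_iff)
qed

text \<open>
  The function itself is integrated against \<open>J\<close>, its first derivatives against the divergence (and
  they serve as test functions for the normal trace), its second derivatives against \<open>J\<close> again.
\<close>

lemma smooth_spherical_j0:
  fixes x :: "real^3"
  assumes \<phi>: "\<phi> = (\<lambda>z. complex_of_real (spherical_j0 (\<kappa> * norm (x - z))))"
  shows "smooth \<phi>" "smooth (partial i \<phi>)" "smooth (partial j (partial i \<phi>))"
proof -
  obtain F :: "nat \<Rightarrow> real \<Rightarrow> real" where F: "\<And>m t. (F m has_real_derivative F (Suc m) t) (at t)"
    "\<And>r. F 0 (r\<^sup>2) = spherical_j0 (\<kappa> * r)" using spherical_j0_entire[of \<kappa>] by blast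
  have "\<phi> = (\<lambda>z. of_real (F 0 ((norm (z - x))\<^sup>2)))"
    unfolding \<phi> F(2) by (simp add: norm_minus_commute)
  then have A: "\<phi> \<in> entire_radial_algebra F x" by (simp only: entire_radial_algebra.radial)
  then show "smooth \<phi>" "smooth (partial i \<phi>)" "smooth (partial j (partial i \<phi>))"
    using smooth_entire_radial_algebra[where F = F, OF F(1)] entire_radial_algebra_derivative(2)[where F = F, OF F(1)] by blast+
qed

lemma smooth_imp_continuous: "smooth f \<Longrightarrow> continuous_on UNIV f"
  unfolding smooth_def using Ck.simps(1) by blast

section \<open>The Maxwell dyads\<close>

definition spherical_wave :: "complex \<Rightarrow> real \<Rightarrow> complex" where
  "spherical_wave c r = exp (c * of_real r) / of_real r"

lemma spherical_wave_derivs: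
  assumes "r > 0"
  shows "(spherical_wave c has_vector_derivative (c - 1 / of_real r) * spherical_wave c r) (at r)"
    "((\<lambda>r. (c - 1 / of_real r) * spherical_wave c r) has_vector_derivative
      (c\<^sup>2 - 2 * c / of_real r + 2 / (of_real r)\<^sup>2) * spherical_wave c r) (at r)"
proof -
  have r: "complex_of_real r \<noteq> 0" using assms by simp
  have 0: "(spherical_wave c has_vector_derivative (c - 1 / of_real r) * spherical_wave c r) (at r)" if "r > 0" for r
  proof -
    have r: "complex_of_real r \<noteq> 0" using that by simp
    have "((\<lambda>z. exp (c * z) / z) has_field_derivative (c - 1 / of_real r) * spherical_wave c r) (at (of_real r))"
      unfolding spherical_wave_def using r
      by (auto intro!: derivative_eq_intros simp: field_simps power2_eq_square)
    from has_vector_derivative_real_field[OF this] show ?thesis unfolding spherical_wave_def .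
  qed
  then show "(spherical_wave c has_vector_derivative (c - 1 / of_real r) * spherical_wave c r) (at r)"
    using assms .
  have "((\<lambda>z. (c - 1 / z) * (exp (c * z) / z)) has_field_derivative
      (c\<^sup>2 - 2 * c / of_real r + 2 / (of_real r)\<^sup>2) * spherical_wave c r) (at (of_real r))"
    unfolding spherical_wave_def using r
    by (auto intro!: derivative_eq_intros simp: field_simps power2_eq_square)
  from has_vector_derivative_real_field[OF this]
  show "((\<lambda>r. (c - 1 / of_real r) * spherical_wave c r) has_vector_derivative
      (c\<^sup>2 - 2 * c / of_real r + 2 / (of_real r)\<^sup>2) * spherical_wave c r) (at r)"
    unfolding spherical_wave_def .
qed

text \<open>
  The closed form of \<open>(I + \<kappa>\<^sup>-\<^sup>2 \<nabla>\<nabla>) (exp (\<i> \<kappa> q) / (4 \<pi> q))\<close> at displacement \<open>d\<close>, where \<open>q\<close> stands for a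
  distance with a sign. The value \<open>q = |d|\<close> gives the outgoing dyad, and \<open>q = - |d|\<close> the negative of
  the incoming one. Leaving \<open>q\<close> complex prepares the continuation along rays.
\<close>

definition maxwell_kernel :: "real \<Rightarrow> 3 \<Rightarrow> 3 \<Rightarrow> complex \<Rightarrow> real^3 \<Rightarrow> complex" where
  "maxwell_kernel \<kappa> i j q d = exp (\<i> * of_real \<kappa> * q) / (4 * of_real pi * q) *
     ((if i = j then 1 + (\<i> * of_real \<kappa> / q - 1 / q\<^sup>2) / (of_real \<kappa>)\<^sup>2 else 0) +
      of_real (d $ i * d $ j) / q\<^sup>2 * ((- ((of_real \<kappa>)\<^sup>2) - 3 * \<i> * of_real \<kappa> / q + 3 / q\<^sup>2) / (of_real \<kappa>)\<^sup>2))"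

lemma hessian_spherical_wave:
  fixes x y :: "real^3"
  assumes "x \<noteq> y"
  shows "partial i (partial j (\<lambda>z. spherical_wave c (norm (z - y)))) x =
    spherical_wave c (norm (x - y)) * ((if i = j then c / of_real (norm (x - y)) - 1 / (of_real (norm (x - y)))\<^sup>2 else 0)
     + of_real ((x - y) $ i * (x - y) $ j) / (of_real (norm (x - y)))\<^sup>2 *
       (c\<^sup>2 - 3 * c / of_real (norm (x - y)) + 3 / (of_real (norm (x - y)))\<^sup>2))"
proof -
  define q where "q = complex_of_real (norm (x - y))"
  have q: "q \<noteq> 0" unfolding q_def using assms by simp
  define w where "w = spherical_wave c (norm (x - y))"
  define e where "e = complex_of_real ((x - y) $ i * (x - y) $ j)"
  have 1: "(c - 1 / q) * w / q = w * (c / q - 1 / q\<^sup>2)"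
    using q by (simp add: field_simps power2_eq_square)
  have "(c\<^sup>2 - 2 * c / q + 2 / q\<^sup>2) * w - (c - 1 / q) * w / q = w * (c\<^sup>2 - 3 * c / q + 3 / q\<^sup>2)"
    using q by (simp add: field_simps power2_eq_square)
  then have 2: "e / q\<^sup>2 * ((c\<^sup>2 - 2 * c / q + 2 / q\<^sup>2) * w - (c - 1 / q) * w / q) = w * (e / q\<^sup>2 * (c\<^sup>2 - 3 * c / q + 3 / q\<^sup>2))"
    by simp
  show ?thesis
    by (simp only: hessian_radial[where h = "spherical_wave c", OF assms spherical_wave_derivs(1) spherical_wave_derivs(2)]
        q_def[symmetric] w_def[symmetric] e_def[symmetric] 2) (simp add: 1 distrib_left)
qed

text \<open>
  Both signs at once: \<open>\<sigma> = 1\<close> is the outgoing and \<open>\<sigma> = - 1\<close> the incoming wave. The factor \<open>\<sigma>\<close> in front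
  comes from the denominator \<open>4 \<pi> q\<close>.
\<close>

lemma maxwell_kernel_eq_hessian:
  fixes x y :: "real^3"
  assumes "x \<noteq> y" "\<kappa> \<noteq> 0" "\<sigma> = 1 \<or> \<sigma> = -1"
  shows "maxwell_kernel \<kappa> i j (of_real (\<sigma> * norm (x - y))) (x - y) =
    of_real (\<sigma> / (4 * pi)) * ((if i = j then spherical_wave (\<i> * of_real (\<sigma> * \<kappa>)) (norm (x - y)) else 0) +
     of_real (1 / \<kappa>\<^sup>2) * partial i (partial j (\<lambda>z. spherical_wave (\<i> * of_real (\<sigma> * \<kappa>)) (norm (z - y)))) x)"
proof -
  define q where "q = complex_of_real (norm (x - y))"
  define k where "k = complex_of_real \<kappa>"
  define s where "s = complex_of_real \<sigma>"
  have q: "q \<noteq> 0" "k \<noteq> 0" unfolding q_def k_def using assms by simp_all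
  have s: "s * s = 1" "s \<noteq> 0" "s\<^sup>2 = 1" unfolding s_def using assms(3) by auto
  define a where "a = exp (\<i> * k * (s * q))"
  define e where "e = complex_of_real ((x - y) $ i * (x - y) $ j)"
  have w: "spherical_wave (\<i> * of_real (\<sigma> * \<kappa>)) (norm (x - y)) = a / q"
    unfolding spherical_wave_def a_def q_def k_def s_def by (simp add: mult_ac)
  have "a / (4 * of_real pi * (s * q)) *
     ((if i = j then 1 + (\<i> * k / (s * q) - 1 / (s * q)\<^sup>2) / k\<^sup>2 else 0) +
      e / (s * q)\<^sup>2 * ((- (k\<^sup>2) - 3 * \<i> * k / (s * q) + 3 / (s * q)\<^sup>2) / k\<^sup>2)) =
    s / (4 * of_real pi) * ((if i = j then a / q else 0) + 1 / k\<^sup>2 * (a / q *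
    ((if i = j then \<i> * (s * k) / q - 1 / q\<^sup>2 else 0) + e / q\<^sup>2 * ((\<i> * (s * k))\<^sup>2 - 3 * (\<i> * (s * k)) / q + 3 / q\<^sup>2))))"
  proof -
    have "(s * q)\<^sup>2 = q\<^sup>2" "(\<i> * (s * k))\<^sup>2 = - (k\<^sup>2)"
      using s by (simp_all add: power_mult_distrib)
    moreover have "b / (s * q) = s * b / q" for b using s(1,2) q by (simp add: field_simps)
    moreover have "a / (4 * of_real pi * (s * q)) = s / (4 * of_real pi) * (a / q)" using s(1,2) q by (simp add: field_simps)
    ultimately show ?thesis using q by (cases "i = j") (simp_all add: algebra_simps add_divide_distrib diff_divide_distrib)
  qed
  then show ?thesis
    unfolding hessian_spherical_wave[OF assms(1)] w maxwell_kernel_def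
    unfolding of_real_mult of_real_divide of_real_1 of_real_power of_real_numeral k_def[symmetric] q_def[symmetric] s_def[symmetric] a_def[symmetric] e_def[unfolded of_real_mult, symmetric]
    by (simp only: mult.assoc)
qed

text \<open>
  Linearity of the Hessian on radial functions, read off from the explicit formula; it saves
  tracking differentiability of the intermediate partial derivatives.
\<close>

lemma hessian_radial_linear:
  fixes f g :: "real \<Rightarrow> complex" and x p :: "real^'n::finite"
  assumes xp: "x \<noteq> p"
    and f1: "\<And>r. r > 0 \<Longrightarrow> (f has_vector_derivative f1 r) (at r)"
    and f2: "\<And>r. r > 0 \<Longrightarrow> (f1 has_vector_derivative f2 r) (at r)"
    and g1: "\<And>r. r > 0 \<Longrightarrow> (g has_vector_derivative g1 r) (at r)"
    and g2: "\<And>r. r > 0 \<Longrightarrow> (g1 has_vector_derivative g2 r) (at r)"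
  shows "partial i (partial j (\<lambda>z. a * f (norm (z - p)) + b * g (norm (z - p)))) x =
    a * partial i (partial j (\<lambda>z. f (norm (z - p)))) x + b * partial i (partial j (\<lambda>z. g (norm (z - p)))) x"
proof -
  have 1: "((\<lambda>r. a * f r + b * g r) has_vector_derivative a * f1 r + b * g1 r) (at r)" if "r > 0" for r
    using f1[OF that] g1[OF that] by (intro derivative_intros)
  have 2: "((\<lambda>r. a * f1 r + b * g1 r) has_vector_derivative a * f2 r + b * g2 r) (at r)" if "r > 0" for r
    using f2[OF that] g2[OF that] by (intro derivative_intros)
  show ?thesis
    by (simp only: hessian_radial[where h = "\<lambda>r. a * f r + b * g r", OF xp 1 2]
      hessian_radial[where h = f, OF xp f1 f2] hessian_radial[where h = g, OF xp g1 g2])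
     (simp add: algebra_simps add_divide_distrib diff_divide_distrib)
qed

lemma green_tensor_eq:
  assumes "x \<noteq> y" "\<kappa> \<noteq> 0"
  shows "green_tensor \<kappa> x y $ i $ j = maxwell_kernel \<kappa> i j (of_real (norm (x - y))) (x - y)"
proof -
  let ?w = "spherical_wave (\<i> * of_real \<kappa>)"
  \<comment> \<open>The zero summand lets the two-term linearity lemma serve for a single wave.\<close>
  have g: "green \<kappa> z y = of_real (1 / (4 * pi)) * ?w (norm (z - y)) + 0 * ?w (norm (z - y))" for z
    unfolding green_def spherical_wave_def by (simp add: mult.assoc)
  have h: "hessian (\<lambda>z. green \<kappa> z y) x $ i $ j =
      of_real (1 / (4 * pi)) * partial i (partial j (\<lambda>z. ?w (norm (z - y)))) x +
      0 * partial i (partial j (\<lambda>z. ?w (norm (z - y)))) x"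
    unfolding hessian_def g vec_lambda_beta
    by (rule hessian_radial_linear[OF assms(1) spherical_wave_derivs(1) spherical_wave_derivs(2) spherical_wave_derivs(1) spherical_wave_derivs(2)])
  show ?thesis
    using maxwell_kernel_eq_hessian[OF assms, of 1 i j]
    unfolding green_tensor_def vector_add_component vector_scaleR_component h
    by (simp add: mat_def g[of x] scaleR_conv_of_real distrib_left mult_ac)
qed

lemma spherical_j0_eq_waves:
  assumes "r > 0" "\<kappa> \<noteq> 0"
  shows "complex_of_real (spherical_j0 (\<kappa> * r)) =
    1 / (2 * \<i> * of_real \<kappa>) * spherical_wave (\<i> * of_real \<kappa>) r + (- 1 / (2 * \<i> * of_real \<kappa>)) * spherical_wave (- (\<i> * of_real \<kappa>)) r"
proof -
  have "complex_of_real (sin (\<kappa> * r)) = (exp (\<i> * of_real \<kappa> * of_real r) - exp (- (\<i> * of_real \<kappa>) * of_real r)) / (2 * \<i>)"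
    using sin_exp_eq[of "of_real (\<kappa> * r)"] by (simp add: sin_of_real[symmetric] mult.assoc del: sin_of_real)
  then have "complex_of_real (sin (\<kappa> * r) / (\<kappa> * r)) = (exp (\<i> * of_real \<kappa> * of_real r) - exp (- (\<i> * of_real \<kappa>) * of_real r)) / (2 * \<i>) / (of_real \<kappa> * of_real r)"
    by (simp only: of_real_divide of_real_mult)
  moreover have "(a - b) / (2 * \<i>) / (of_real \<kappa> * of_real r) = 1 / (2 * \<i> * of_real \<kappa>) * (a / of_real r) + (- 1 / (2 * \<i> * of_real \<kappa>)) * (b / of_real r)" for a b
    by (simp add: diff_divide_distrib mult_ac)
  ultimately show ?thesis
    using assms unfolding spherical_j0_def spherical_wave_def by simp
qed

text \<open>
  By Euler's formula \<open>j\<^sub>0(\<kappa> r)\<close> is a difference of an outgoing and an incoming wave; since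
  \<open>maxwell_kernel\<close> at a negative distance already carries a minus sign, the difference appears as
  a sum. The derivatives are taken in \<open>y\<close>, as in the null space, while the dyads depend on
  \<open>x - y\<close>; the two sign changes cancel.
\<close>

lemma j0_dyad_eq:
  assumes "x \<noteq> y" "\<kappa> \<noteq> 0"
  shows "(if i = j then of_real (spherical_j0 (\<kappa> * norm (x - y))) else 0) +
      of_real (1 / \<kappa>\<^sup>2) * partial j (partial i (\<lambda>z. complex_of_real (spherical_j0 (\<kappa> * norm (x - z))))) y
    = of_real (2 * pi / \<kappa>) / \<i> * (maxwell_kernel \<kappa> i j (of_real (norm (x - y))) (x - y) +
        maxwell_kernel \<kappa> i j (- of_real (norm (x - y))) (x - y))"
proof -
  let ?w = "spherical_wave (\<i> * of_real \<kappa>)" and ?v = "spherical_wave (- (\<i> * of_real \<kappa>))"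
  let ?c = "1 / (2 * \<i> * complex_of_real \<kappa>)"
  have yx: "y \<noteq> x" using assms by simp
  have sym: "maxwell_kernel \<kappa> i j q (x - y) = maxwell_kernel \<kappa> j i q (y - x)" for q
    unfolding maxwell_kernel_def by (simp add: mult.commute algebra_simps)
  have "partial j (partial i (\<lambda>z. complex_of_real (spherical_j0 (\<kappa> * norm (x - z))))) y
     = partial j (partial i (\<lambda>z. ?c * ?w (norm (z - x)) + (- 1 / (2 * \<i> * of_real \<kappa>)) * ?v (norm (z - x)))) y"
    by (rule hessian_transform[of "- {x}"])
       (use yx assms in \<open>auto simp: norm_minus_commute[of x] spherical_j0_eq_waves simp del: of_real_mult\<close>)
  also have "\<dots> = ?c * partial j (partial i (\<lambda>z. ?w (norm (z - x)))) y
       + (- 1 / (2 * \<i> * of_real \<kappa>)) * partial j (partial i (\<lambda>z. ?v (norm (z - x)))) y"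
    by (rule hessian_radial_linear[OF yx spherical_wave_derivs(1) spherical_wave_derivs(2) spherical_wave_derivs(1) spherical_wave_derivs(2)])
  finally have h: "partial j (partial i (\<lambda>z. complex_of_real (spherical_j0 (\<kappa> * norm (x - z))))) y = \<dots>" .
  have j: "complex_of_real (spherical_j0 (\<kappa> * norm (x - y))) = ?c * ?w (norm (y - x)) + (- 1 / (2 * \<i> * of_real \<kappa>)) * ?v (norm (y - x))"
    using spherical_j0_eq_waves[of "norm (y - x)" \<kappa>] assms by (simp add: norm_minus_commute)
  have p: "maxwell_kernel \<kappa> j i (of_real (norm (y - x))) (y - x) =
    of_real (1 / (4 * pi)) * ((if j = i then ?w (norm (y - x)) else 0) +
     of_real (1 / \<kappa>\<^sup>2) * partial j (partial i (\<lambda>z. ?w (norm (z - x)))) y)"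
    using maxwell_kernel_eq_hessian[OF yx assms(2), of 1 j i] by simp
  have m: "maxwell_kernel \<kappa> j i (- of_real (norm (y - x))) (y - x) =
    of_real (- 1 / (4 * pi)) * ((if j = i then ?v (norm (y - x)) else 0) +
     of_real (1 / \<kappa>\<^sup>2) * partial j (partial i (\<lambda>z. ?v (norm (z - x)))) y)"
    using maxwell_kernel_eq_hessian[OF yx assms(2), of "-1" j i] by simp
  have c: "of_real (2 * pi / \<kappa>) / \<i> * (of_real (1 / (4 * pi)) * a + of_real (- 1 / (4 * pi)) * b)
      = ?c * a + (- 1 / (2 * \<i> * of_real \<kappa>)) * b" for a b
    using assms by (simp add: field_simps)
  show ?thesis
    unfolding sym norm_minus_commute[of x y] p m c h j[unfolded norm_minus_commute[of x y]]
    by (cases "i = j") (simp_all add: algebra_simps)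
qed

lemma continuous_on_maxwell_kernel:
  assumes "x \<notin> S" "\<kappa> \<noteq> 0"
  shows "continuous_on S (\<lambda>y. maxwell_kernel \<kappa> i j (of_real (norm (x - y))) (x - y))"
proof -
  have nz: "complex_of_real (norm (x - y)) \<noteq> 0" if "y \<in> S" for y using assms that by auto
  have "continuous_on S (\<lambda>y. complex_of_real (norm (x - y)))"
    "\<And>i j. continuous_on S (\<lambda>y. complex_of_real ((x - y) $ i * (x - y) $ j))"
    by (intro continuous_intros)+
  note fs = this
  have nz': "4 * of_real pi * complex_of_real (norm (x - y)) \<noteq> 0" "(complex_of_real (norm (x - y)))\<^sup>2 \<noteq> 0" if "y \<in> S" for y
    using nz[OF that] by simp_all
  have k: "(complex_of_real \<kappa>)\<^sup>2 \<noteq> 0" using assms(2) by simp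
  show ?thesis
    unfolding maxwell_kernel_def
    by (cases "i = j"; simp only: if_True if_False simp_thms;
        intro continuous_on_mult continuous_on_divide continuous_on_add continuous_on_diff continuous_on_minus
          continuous_on_power continuous_on_exp continuous_on_const fs ballI nz nz' k)
qed

section \<open>Analytic continuation of the kernel along a ray\<close>

text \<open>
  For real \<open>s\<close> and unit \<open>\<omega>\<close> this is \<open>|\<omega> - s y|\<close>; the distance from \<open>\<omega> / s\<close> to \<open>y\<close> is its quotient by
  \<open>|s|\<close>.
\<close>

definition ray_root :: "real^3 \<Rightarrow> complex \<Rightarrow> real^3 \<Rightarrow> complex" where
  "ray_root \<omega> s y = csqrt (1 - 2 * s * of_real (\<omega> \<bullet> y) + s\<^sup>2 * of_real ((norm y)\<^sup>2))"

text \<open>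
  This is \<open>exp (- \<i> \<kappa> / s)\<close> times \<open>maxwell_kernel\<close> at signed distance \<open>P / s\<close> and displacement
  \<open>\<omega> / s - y\<close>, with all singular quotients cancelled: \<open>u = s / P\<close> is the reciprocal of the signed
  distance, and \<open>(s |y|\<^sup>2 - 2 \<omega> \<bullet> y) / (P + 1)\<close> is \<open>(P - 1) / s\<close>, because the numerator times \<open>s\<close> is
  \<open>P\<^sup>2 - 1\<close>. In this form it makes sense and is holomorphic at \<open>s = 0\<close>.
\<close>

definition ray_kernel :: "real \<Rightarrow> real^3 \<Rightarrow> 3 \<Rightarrow> 3 \<Rightarrow> complex \<Rightarrow> real^3 \<Rightarrow> complex" where
  "ray_kernel \<kappa> \<omega> i j s y = (let P = ray_root \<omega> s y; u = s / P in
     exp (\<i> * of_real \<kappa> * ((s * of_real ((norm y)\<^sup>2) - 2 * of_real (\<omega> \<bullet> y)) / (P + 1))) * u * of_real (1 / (4 * pi)) *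
     ((if i = j then 1 + (\<i> * of_real \<kappa> * u - u\<^sup>2) * of_real (1 / \<kappa>\<^sup>2) else 0) +
      (of_real (\<omega> $ i) - s * of_real (y $ i)) / P * ((of_real (\<omega> $ j) - s * of_real (y $ j)) / P) *
        ((- ((of_real \<kappa>)\<^sup>2) - 3 * \<i> * of_real \<kappa> * u + 3 * u\<^sup>2) * of_real (1 / \<kappa>\<^sup>2))))"

text \<open>
  With \<open>s = a + \<i> b\<close> and \<open>t = \<omega> \<bullet> y\<close>, the imaginary part is \<open>2 b (a |y|\<^sup>2 - t)\<close>. If it vanishes, then
  either \<open>s\<close> is real, and the radicand is at least \<open>(1 - |a| |y|)\<^sup>2 > 0\<close>, or \<open>t = a |y|\<^sup>2\<close>, and it equals
  \<open>1 - |s|\<^sup>2 |y|\<^sup>2 > 0\<close>.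
\<close>

lemma ray_radicand_notin_nonpos:
  fixes \<omega> y :: "real^3" and s :: complex
  assumes "norm \<omega> = 1" "norm s * norm y < 1"
  shows "1 - 2 * s * of_real (\<omega> \<bullet> y) + s\<^sup>2 * of_real ((norm y)\<^sup>2) \<notin> \<real>\<^sub>\<le>\<^sub>0"
proof
  define a b t m where "a = Re s" and "b = Im s" and "t = \<omega> \<bullet> y" and "m = norm y"
  have t: "\<bar>t\<bar> \<le> m" using Cauchy_Schwarz_ineq2[of \<omega> y] assms(1) unfolding t_def m_def by simp
  have sm: "(norm s * m)\<^sup>2 < 1" using assms(2) unfolding m_def by (simp add: abs_square_less_1)
  then have sm': "(a\<^sup>2 + b\<^sup>2) * m\<^sup>2 < 1" unfolding power_mult_distrib cmod_power2 a_def b_def .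
  assume "1 - 2 * s * of_real (\<omega> \<bullet> y) + s\<^sup>2 * of_real ((norm y)\<^sup>2) \<in> \<real>\<^sub>\<le>\<^sub>0"
  then have re: "1 - 2 * a * t + (a\<^sup>2 - b\<^sup>2) * m\<^sup>2 \<le> 0" and im: "2 * b * (a * m\<^sup>2 - t) = 0"
    unfolding complex_nonpos_Reals_iff a_def b_def t_def m_def
    by (simp_all add: power2_eq_square algebra_simps)
  show False
  proof (cases "b = 0")
    case True
    have "(\<bar>a\<bar> * m)\<^sup>2 < 1" using sm' True by (simp add: power_mult_distrib)
    then have "\<bar>a\<bar> * m < 1" unfolding abs_square_less_1 by linarith
    moreover have "a * t \<le> \<bar>a\<bar> * m" using abs_ge_self[of "a * t"] mult_left_mono[OF t abs_ge_zero[of a]] unfolding abs_mult by linarith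
    ultimately have "0 < (1 - \<bar>a\<bar> * m)\<^sup>2 + 2 * (\<bar>a\<bar> * m - a * t)" by (simp add: add_pos_nonneg)
    also have "\<dots> = 1 - 2 * a * t + (a\<^sup>2 - b\<^sup>2) * m\<^sup>2"
      using True by (simp add: power2_eq_square algebra_simps)
    finally show False using re by simp
  next
    case False
    then have "t = a * m\<^sup>2" using im by simp
    then have "1 - 2 * a * t + (a\<^sup>2 - b\<^sup>2) * m\<^sup>2 = 1 - (a\<^sup>2 + b\<^sup>2) * m\<^sup>2"
      by (simp add: power2_eq_square algebra_simps)
    then show False using re sm' by simp
  qed
qed

lemma ray_root_nonzero:
  assumes "norm \<omega> = 1" "norm s * norm y < 1"
  shows "ray_root \<omega> s y \<noteq> 0" "ray_root \<omega> s y + 1 \<noteq> 0"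
proof -
  show "ray_root \<omega> s y \<noteq> 0"
    using ray_radicand_notin_nonpos[OF assms] unfolding ray_root_def by force
  have "Re (ray_root \<omega> s y + 1) > 0"
    unfolding ray_root_def using Re_csqrt by (simp add: add_nonneg_pos del: csqrt.simps)
  then show "ray_root \<omega> s y + 1 \<noteq> 0" by (metis less_irrefl zero_complex.sel(1))
qed

lemma holomorphic_on_ray_kernel:
  assumes "norm \<omega> = 1" "norm y < \<rho>" "\<rho> > 0"
  shows "(\<lambda>s. ray_kernel \<kappa> \<omega> i j s y) holomorphic_on ball 0 (1 / \<rho>)"
proof -
  have m: "norm s * norm y < 1" if "s \<in> ball 0 (1 / \<rho>)" for s :: complex
  proof -
    have "norm s * norm y \<le> norm s * \<rho>" using assms by (simp add: mult_left_mono)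
    also have "\<dots> < 1" using that assms by (simp add: field_simps)
    finally show ?thesis .
  qed
  have root: "(\<lambda>s. ray_root \<omega> s y) holomorphic_on ball 0 (1 / \<rho>)"
    unfolding ray_root_def
    by (intro holomorphic_intros) (use ray_radicand_notin_nonpos[OF assms(1) m] in auto)
  note nz = ray_root_nonzero[OF assms(1) m]
  have form: "(\<lambda>s. exp (\<i> * of_real \<kappa> * X s) * U s * c * ((if i = j then 1 + (\<i> * of_real \<kappa> * U s - (U s)\<^sup>2) * d else 0) +
      D s * D' s * ((- ((of_real \<kappa>)\<^sup>2) - 3 * \<i> * of_real \<kappa> * U s + 3 * (U s)\<^sup>2) * d))) holomorphic_on A"
    if "X holomorphic_on A" "U holomorphic_on A" "D holomorphic_on A" "D' holomorphic_on A" for X U D D' A c d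
    by (cases "i = j") (use that in \<open>auto intro!: holomorphic_intros\<close>)
  show ?thesis
    unfolding ray_kernel_def Let_def
    by (rule form; intro holomorphic_on_divide holomorphic_on_add holomorphic_on_diff holomorphic_on_mult
        holomorphic_on_ident holomorphic_on_const root nz)
qed

lemma continuous_on_ray_kernel:
  assumes "norm \<omega> = 1"
  shows "continuous_on {(s, y). norm s * norm y < 1} (\<lambda>(s, y). ray_kernel \<kappa> \<omega> i j s y)"
proof -
  let ?S = "{(s :: complex, y :: real^3). norm s * norm y < 1}"
  have root: "continuous_on ?S (\<lambda>p. ray_root \<omega> (fst p) (snd p))"
    unfolding ray_root_def
    by (rule continuous_on_compose2[OF continuous_on_csqrt]; (intro continuous_intros)?)
       (use ray_radicand_notin_nonpos[OF assms(1)] in auto)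
  have nz: "ray_root \<omega> (fst p) (snd p) \<noteq> 0" "ray_root \<omega> (fst p) (snd p) + 1 \<noteq> 0" if "p \<in> ?S" for p
    using ray_root_nonzero[OF assms(1), of "fst p" "snd p"] that by auto
  have form: "continuous_on A (\<lambda>s. exp (\<i> * of_real \<kappa> * X s) * U s * c * ((if i = j then 1 + (\<i> * of_real \<kappa> * U s - (U s)\<^sup>2) * d else 0) +
      D s * D' s * ((- ((of_real \<kappa>)\<^sup>2) - 3 * \<i> * of_real \<kappa> * U s + 3 * (U s)\<^sup>2) * d)))"
    if "continuous_on A X" "continuous_on A U" "continuous_on A D" "continuous_on A D'"
    for X U D D' :: "complex \<times> (real^3) \<Rightarrow> complex" and A c d
    by (cases "i = j") (use that in \<open>auto intro!: continuous_intros\<close>)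
  have fs: "continuous_on ?S fst" "continuous_on ?S (\<lambda>p. complex_of_real ((norm (snd p))\<^sup>2))"
    "continuous_on ?S (\<lambda>p. complex_of_real (\<omega> \<bullet> snd p))" "\<And>k. continuous_on ?S (\<lambda>p. complex_of_real (snd p $ k))"
    by (intro continuous_intros)+
  have "continuous_on ?S (\<lambda>p. ray_kernel \<kappa> \<omega> i j (fst p) (snd p))"
    unfolding ray_kernel_def Let_def
    by (rule form; intro continuous_on_divide continuous_on_add continuous_on_diff continuous_on_mult
        continuous_on_const root fs ballI nz)
  then show ?thesis by (simp add: case_prod_beta)
qed

lemma ray_root_of_real:
  assumes "norm \<omega> = 1"
  shows "ray_root \<omega> (of_real s) y = of_real (norm (\<omega> - s *\<^sub>R y))"
proof -
  have "1 - 2 * s * (\<omega> \<bullet> y) + s\<^sup>2 * (norm y)\<^sup>2 = (norm (\<omega> - s *\<^sub>R y))\<^sup>2"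
    using assms unfolding power2_norm_eq_inner norm_eq_1
    by (simp add: inner_diff_left inner_diff_right inner_commute power2_eq_square)
  then have "1 - 2 * of_real s * of_real (\<omega> \<bullet> y) + (of_real s)\<^sup>2 * of_real ((norm y)\<^sup>2)
      = complex_of_real ((norm (\<omega> - s *\<^sub>R y))\<^sup>2)"
    by (metis (no_types, lifting) of_real_1 of_real_add of_real_diff of_real_mult of_real_numeral of_real_power)
  then show ?thesis unfolding ray_root_def by (simp add: csqrt_of_real del: of_real_power)
qed

text \<open>
  For negative \<open>s\<close> the point \<open>\<omega> / s\<close> lies in direction \<open>- \<omega>\<close> and \<open>P / s\<close> is minus the distance; this
  is how the incoming wave arises from the same holomorphic function.
\<close>

lemma ray_kernel_of_real:
  assumes \<omega>: "norm \<omega> = 1" and s: "s \<noteq> 0" "\<bar>s\<bar> * norm y < 1"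
  shows "exp (\<i> * of_real (\<kappa> / s)) * ray_kernel \<kappa> \<omega> i j (of_real s) y =
    maxwell_kernel \<kappa> i j (of_real (sgn s * norm ((1 / s) *\<^sub>R \<omega> - y))) ((1 / s) *\<^sub>R \<omega> - y)"
proof -
  define P where "P = ray_root \<omega> (of_real s) y"
  have P: "P \<noteq> 0" "P + 1 \<noteq> 0" using ray_root_nonzero[OF \<omega>, of "of_real s" y] s unfolding P_def by auto
  have "norm (\<omega> - s *\<^sub>R y) = norm (s *\<^sub>R ((1 / s) *\<^sub>R \<omega> - y))"
    using s by (simp add: scaleR_diff_right)
  also have "\<dots> = s * (sgn s * norm ((1 / s) *\<^sub>R \<omega> - y))"
    by (simp add: sgn_mult abs_sgn mult.assoc abs_mult)
  finally have q: "of_real (sgn s * norm ((1 / s) *\<^sub>R \<omega> - y)) = P / of_real s"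
    using s unfolding P_def ray_root_of_real[OF \<omega>] by simp
  have P2: "P\<^sup>2 = 1 - 2 * of_real s * of_real (\<omega> \<bullet> y) + (of_real s)\<^sup>2 * of_real ((norm y)\<^sup>2)"
    unfolding P_def ray_root_def by (simp only: power2_csqrt)
  have "(of_real s * of_real ((norm y)\<^sup>2) - 2 * of_real (\<omega> \<bullet> y)) / (P + 1) = (P - 1) / of_real s"
    using P s P2 by (simp add: divide_simps) (simp add: power2_eq_square algebra_simps)
  note X = this
  have e: "exp (\<i> * of_real (\<kappa> / s)) * exp (\<i> * of_real \<kappa> * ((of_real s * of_real ((norm y)\<^sup>2) - 2 * of_real (\<omega> \<bullet> y)) / (P + 1)))
      = exp (\<i> * of_real \<kappa> * (P / of_real s))"
    unfolding X exp_add[symmetric] using s by (intro arg_cong[of _ _ exp]) (simp add: diff_divide_distrib right_diff_distrib)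
  have d: "complex_of_real (\<omega> $ k) - of_real s * of_real (y $ k) = of_real s * of_real (((1 / s) *\<^sub>R \<omega> - y) $ k)" for k
    using s by (simp add: algebra_simps)
  have u: "of_real s / P = 1 / (P / of_real s)" by simp
  have "exp (\<i> * of_real (\<kappa> / s)) * ray_kernel \<kappa> \<omega> i j (of_real s) y =
      exp (\<i> * of_real \<kappa> * (P / of_real s)) * (of_real s / P) * of_real (1 / (4 * pi)) *
     ((if i = j then 1 + (\<i> * of_real \<kappa> * (of_real s / P) - (of_real s / P)\<^sup>2) * of_real (1 / \<kappa>\<^sup>2) else 0) +
      of_real s * of_real (((1 / s) *\<^sub>R \<omega> - y) $ i) / P * (of_real s * of_real (((1 / s) *\<^sub>R \<omega> - y) $ j) / P) *
        ((- ((of_real \<kappa>)\<^sup>2) - 3 * \<i> * of_real \<kappa> * (of_real s / P) + 3 * (of_real s / P)\<^sup>2) * of_real (1 / \<kappa>\<^sup>2)))"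
    unfolding ray_kernel_def Let_def P_def[symmetric] d e[symmetric] by (simp only: mult.assoc)
  also have "\<dots> = exp (\<i> * of_real \<kappa> * (P / of_real s)) * (of_real s / P) * of_real (1 / (4 * pi)) *
     ((if i = j then 1 + (\<i> * of_real \<kappa> * (of_real s / P) - (of_real s / P)\<^sup>2) * of_real (1 / \<kappa>\<^sup>2) else 0) +
      of_real (((1 / s) *\<^sub>R \<omega> - y) $ i) * of_real (((1 / s) *\<^sub>R \<omega> - y) $ j) * (of_real s / P)\<^sup>2 *
        ((- ((of_real \<kappa>)\<^sup>2) - 3 * \<i> * of_real \<kappa> * (of_real s / P) + 3 * (of_real s / P)\<^sup>2) * of_real (1 / \<kappa>\<^sup>2)))"
    by (simp add: power2_eq_square mult_ac)
  also have "\<dots> = maxwell_kernel \<kappa> i j (P / of_real s) ((1 / s) *\<^sub>R \<omega> - y)"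
  proof -
    define q where "q = P / of_real s"
    have 1: "exp (\<i> * of_real \<kappa> * q) * (1 / q) * of_real (1 / (4 * pi)) = exp (\<i> * of_real \<kappa> * q) / (4 * of_real pi * q)"
      by simp
    have 2: "(\<i> * of_real \<kappa> * (1 / q) - (1 / q)\<^sup>2) * of_real (1 / \<kappa>\<^sup>2)
        = (\<i> * of_real \<kappa> / q - 1 / q\<^sup>2) / (of_real \<kappa>)\<^sup>2"
      by (simp add: power_divide)
    have 3: "a * b * (1 / q)\<^sup>2 = a * b / q\<^sup>2" for a b by (simp add: power_divide)
    have 4: "(- ((of_real \<kappa>)\<^sup>2) - 3 * \<i> * of_real \<kappa> * (1 / q) + 3 * (1 / q)\<^sup>2) * of_real (1 / \<kappa>\<^sup>2)
        = (- ((of_real \<kappa>)\<^sup>2) - 3 * \<i> * of_real \<kappa> / q + 3 / q\<^sup>2) / (of_real \<kappa>)\<^sup>2"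
      by (simp add: power_divide)
    show ?thesis unfolding maxwell_kernel_def u q_def[symmetric] 1 2 3 4 by (simp only: of_real_mult)
  qed
  finally show ?thesis unfolding q .
qed

lemma ray_kernel_outgoing:
  assumes "norm \<omega> = 1" "s > 0" "s * norm y < 1"
  shows "exp (\<i> * of_real (\<kappa> / s)) * ray_kernel \<kappa> \<omega> i j (of_real s) y =
    maxwell_kernel \<kappa> i j (of_real (norm ((1 / s) *\<^sub>R \<omega> - y))) ((1 / s) *\<^sub>R \<omega> - y)"
  using ray_kernel_of_real[of \<omega> s y] assms by simp

lemma ray_kernel_incoming:
  assumes "norm \<omega> = 1" "s > 0" "s * norm y < 1"
  shows "exp (- (\<i> * of_real (\<kappa> / s))) * ray_kernel \<kappa> (- \<omega>) i j (- of_real s) y =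
    maxwell_kernel \<kappa> i j (- of_real (norm ((1 / s) *\<^sub>R \<omega> - y))) ((1 / s) *\<^sub>R \<omega> - y)"
  using ray_kernel_of_real[of "- \<omega>" "- s" y] assms by simp

section \<open>Fields along a ray\<close>

text \<open>
  The kernel is cut off outside the ball of radius \<open>\<rho>\<close>, in which the source lives, so that its
  expansion in \<open>s\<close> is under control up to radius \<open>1 / \<rho>\<close>.
\<close>

definition ray_field :: "real \<Rightarrow> real \<Rightarrow> real \<Rightarrow> (real^3 \<Rightarrow> complex^3) \<Rightarrow> real^3 \<Rightarrow> 3 \<Rightarrow> complex \<Rightarrow> complex" where
  "ray_field \<kappa> R \<rho> J \<omega> i s =
     (\<Sum>j\<in>UNIV. LINT y|lebesgue_on (ball 0 R). (if y \<in> cball 0 \<rho> then ray_kernel \<kappa> \<omega> i j s y else 0) * J y $ j)"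

text \<open>
  The disc of radius \<open>1 / \<rho>'\<close> times the ball of radius \<open>\<rho>\<close> is a compact subset of the region
  \<open>|s| |y| < 1\<close> in which the kernel is jointly continuous. The strict inequality \<open>\<rho> < \<rho>'\<close> gives
  room for a uniform bound.
\<close>

lemma ray_kernel_truncated:
  assumes \<omega>: "norm \<omega> = 1" and \<rho>: "0 < \<rho>" "\<rho> < \<rho>'"
  shows "\<exists>B. \<forall>s\<in>cball 0 (1 / \<rho>'). \<forall>y. norm (if y \<in> cball 0 \<rho> then ray_kernel \<kappa> \<omega> i j s y else 0) \<le> B"
    and "s \<in> cball 0 (1 / \<rho>') \<Longrightarrow>
      (\<lambda>y. if y \<in> cball 0 \<rho> then ray_kernel \<kappa> \<omega> i j s y else 0) \<in> borel_measurable (lebesgue_on \<Omega>)"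
proof -
  have in_dom: "cball 0 (1 / \<rho>') \<times> cball 0 \<rho> \<subseteq> {(s :: complex, y :: real^3). norm s * norm y < 1}"
  proof clarify
    fix s :: complex and y :: "real^3" assume "s \<in> cball 0 (1 / \<rho>')" "y \<in> cball 0 \<rho>"
    then have "norm s * norm y \<le> 1 / \<rho>' * \<rho>" using \<rho> by (intro mult_mono) auto
    also have "\<dots> < 1" using \<rho> by simp
    finally show "norm s * norm y < 1" .
  qed
  have cont: "continuous_on (cball 0 (1 / \<rho>') \<times> cball 0 \<rho>) (\<lambda>(s, y). ray_kernel \<kappa> \<omega> i j s y)"
    using continuous_on_subset[OF continuous_on_ray_kernel[OF \<omega>] in_dom] .
  have "compact ((\<lambda>(s, y). ray_kernel \<kappa> \<omega> i j s y) ` (cball 0 (1 / \<rho>') \<times> cball 0 \<rho>))"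
    by (rule compact_continuous_image[OF cont]) (intro compact_Times compact_cball)
  then obtain B where B: "\<And>z. z \<in> (\<lambda>(s, y). ray_kernel \<kappa> \<omega> i j s y) ` (cball 0 (1 / \<rho>') \<times> cball 0 \<rho>) \<Longrightarrow> norm z \<le> B"
    using compact_imp_bounded bounded_iff by metis
  have "norm (if y \<in> cball 0 \<rho> then ray_kernel \<kappa> \<omega> i j s y else 0) \<le> max B 0"
    if "s \<in> cball 0 (1 / \<rho>')" for s y
  proof (cases "y \<in> cball 0 \<rho>")
    case True
    then have "(\<lambda>(s, y). ray_kernel \<kappa> \<omega> i j s y) (s, y) \<in> (\<lambda>(s, y). ray_kernel \<kappa> \<omega> i j s y) ` (cball 0 (1 / \<rho>') \<times> cball 0 \<rho>)"
      using that by (intro imageI) simp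
    then show ?thesis using B True by force
  qed simp
  then show "\<exists>B. \<forall>s\<in>cball 0 (1 / \<rho>'). \<forall>y. norm (if y \<in> cball 0 \<rho> then ray_kernel \<kappa> \<omega> i j s y else 0) \<le> B"
    by blast
  assume s: "s \<in> cball 0 (1 / \<rho>')"
  have "continuous_on (cball 0 \<rho>) (\<lambda>y. (\<lambda>(s, y). ray_kernel \<kappa> \<omega> i j s y) (s, y))"
    by (rule continuous_on_compose2[OF cont]) (use s in \<open>auto intro!: continuous_intros\<close>)
  then have "(\<lambda>y. if y \<in> cball 0 \<rho> then ray_kernel \<kappa> \<omega> i j s y else 0) \<in> borel_measurable borel"
    by (intro borel_measurable_continuous_on_if) auto
  then show "(\<lambda>y. if y \<in> cball 0 \<rho> then ray_kernel \<kappa> \<omega> i j s y else 0) \<in> borel_measurable (lebesgue_on \<Omega>)"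
    by (intro measurable_restrict_space1 measurable_completion) simp
qed

lemma ray_kernel_truncated_integrable:
  assumes "norm \<omega> = 1" "0 < \<rho>" "\<rho> < \<rho>'" "s \<in> cball 0 (1 / \<rho>')"
    and J: "integrable (lebesgue_on \<Omega>) J"
  shows "integrable (lebesgue_on \<Omega>) (\<lambda>y. (if y \<in> cball 0 \<rho> then ray_kernel \<kappa> \<omega> i j s y else 0) * J y $ j)"
proof -
  obtain B where B: "\<forall>s\<in>cball 0 (1 / \<rho>'). \<forall>y. norm (if y \<in> cball 0 \<rho> then ray_kernel \<kappa> \<omega> i j s y else 0) \<le> B"
    using ray_kernel_truncated(1)[OF assms(1-3)] by blast
  have Jj: "integrable (lebesgue_on \<Omega>) (\<lambda>y. J y $ j)"
    by (rule integrable_bounded_linear[OF bounded_linear_vec_nth J])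
  show ?thesis
    using B assms(4) by (intro integrable_bounded_mult[where B = B, OF Jj ray_kernel_truncated(2)[OF assms(1-4)]]) blast
qed

lemma holomorphic_on_ray_field:
  assumes "norm \<omega> = 1" "0 < \<rho>" "\<rho> < \<rho>'" and J: "integrable (lebesgue_on (ball 0 R)) J"
  shows "ray_field \<kappa> R \<rho> J \<omega> i holomorphic_on ball 0 (1 / \<rho>')"
  unfolding ray_field_def
proof (rule holomorphic_on_sum)
  fix j
  obtain B where B: "\<forall>s\<in>cball 0 (1 / \<rho>'). \<forall>y. norm (if y \<in> cball 0 \<rho> then ray_kernel \<kappa> \<omega> i j s y else 0) \<le> B"
    using ray_kernel_truncated(1)[OF assms(1-3)] by blast
  show "(\<lambda>s. LINT y|lebesgue_on (ball 0 R). (if y \<in> cball 0 \<rho> then ray_kernel \<kappa> \<omega> i j s y else 0) * J y $ j)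
      holomorphic_on ball 0 (1 / \<rho>')"
  proof (rule holomorphic_parameter_integral[where B = B])
    show "(\<lambda>s. if y \<in> cball 0 \<rho> then ray_kernel \<kappa> \<omega> i j s y else 0) holomorphic_on ball 0 (1 / \<rho>')" for y
      using holomorphic_on_ray_kernel[OF assms(1), of y \<rho>' \<kappa> i j] assms by (cases "y \<in> cball 0 \<rho>") auto
    show "norm (if y \<in> cball 0 \<rho> then ray_kernel \<kappa> \<omega> i j s y else 0) \<le> B" if "s \<in> ball 0 (1 / \<rho>')" for s y
      using B that by (metis ball_subset_cball subsetD)
    show "(\<lambda>y. if y \<in> cball 0 \<rho> then ray_kernel \<kappa> \<omega> i j s y else 0) \<in> borel_measurable (lebesgue_on (ball 0 R))"
      if "s \<in> ball 0 (1 / \<rho>')" for s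
      using ray_kernel_truncated(2)[OF assms(1-3)] that ball_subset_cball by blast
    show "integrable (lebesgue_on (ball 0 R)) (\<lambda>y. J y $ j)"
      by (rule integrable_bounded_linear[OF bounded_linear_vec_nth J])
  qed auto
qed

text \<open>
  The case \<open>s R = 1\<close> of a point on the sphere is included: there the dyad is unbounded on the ball,
  but the source vanishes near the singularity.
\<close>

lemma electric_field_on_ray:
  assumes \<omega>: "norm \<omega> = 1" and \<rho>: "0 < \<rho>" "\<rho> < R" and s: "0 < s" "s * R \<le> 1" and \<kappa>: "\<kappa> \<noteq> 0"
    and J: "integrable (lebesgue_on (ball 0 R)) J"
    and supp: "AE y in lebesgue_on (ball 0 R). norm y > \<rho> \<longrightarrow> J y = 0"
  shows "electric_field \<kappa> R J ((1 / s) *\<^sub>R \<omega>) $ i = exp (\<i> * of_real (\<kappa> / s)) * ray_field \<kappa> R \<rho> J \<omega> i (of_real s)"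
proof -
  let ?M = "lebesgue_on (ball (0 :: real^3) R)"
  define x where "x = (1 / s) *\<^sub>R \<omega>"
  define e where "e = exp (\<i> * of_real (\<kappa> / s))"
  define f where "f = (\<lambda>i j y. (if y \<in> cball 0 \<rho> then ray_kernel \<kappa> \<omega> i j (of_real s) y else 0) * J y $ j)"
  have sR: "complex_of_real s \<in> cball 0 (1 / R)" using s \<rho> by (simp add: field_simps)
  have f: "integrable ?M (f i j)" for i j
    unfolding f_def by (rule ray_kernel_truncated_integrable[OF \<omega> \<rho> sR J])
  have x: "norm x \<ge> R" unfolding x_def using \<omega> s \<rho> by (simp add: field_simps)
  have xy: "x \<noteq> y" if "y \<in> ball 0 R" for y using x that by auto
  define G where "G = (\<lambda>y. green_tensor \<kappa> x y *v J y)"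
  have Gi: "G y $ i = (\<Sum>j\<in>UNIV. maxwell_kernel \<kappa> i j (of_real (norm (x - y))) (x - y) * J y $ j)" if "y \<in> ball 0 R" for y i
    unfolding G_def matrix_vector_mult_def using green_tensor_eq[OF xy[OF that] \<kappa>] by simp
  have mJ: "(\<lambda>y. J y $ j) \<in> borel_measurable ?M" for j
    by (rule borel_measurable_integrable[OF integrable_bounded_linear[OF bounded_linear_vec_nth J]])
  have cont: "continuous_on (ball 0 R) (\<lambda>y. maxwell_kernel \<kappa> i j (of_real (norm (x - y))) (x - y))" for i j
    by (rule continuous_on_maxwell_kernel) (use x \<kappa> in auto)
  have "(\<lambda>y. maxwell_kernel \<kappa> i j (of_real (norm (x - y))) (x - y)) \<in> borel_measurable ?M" for i j
    by (rule continuous_imp_measurable_on_sets_lebesgue[OF cont]) auto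
  then have "(\<lambda>y. \<Sum>j\<in>UNIV. maxwell_kernel \<kappa> i j (of_real (norm (x - y))) (x - y) * J y $ j) \<in> borel_measurable ?M" for i
    using mJ by (intro borel_measurable_sum borel_measurable_times)
  then have mG: "(\<lambda>y. G y $ i) \<in> borel_measurable ?M" for i
    using Gi by (subst measurable_cong[where g = "\<lambda>y. \<Sum>j\<in>UNIV. maxwell_kernel \<kappa> i j (of_real (norm (x - y))) (x - y) * J y $ j"]) auto
  have ae: "AE y in ?M. G y $ i = (\<Sum>j\<in>UNIV. e * f i j y)" for i
    using supp AE_space
  proof eventually_elim
    case (elim y)
    then have y: "y \<in> ball 0 R" by simp
    have "maxwell_kernel \<kappa> i j (of_real (norm (x - y))) (x - y) * J y $ j = e * f i j y" for j
    proof (cases "norm y \<le> \<rho>")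
      case True
      have "s * norm y < 1"
      proof -
        have "s * norm y < s * R" using True \<rho> s by simp
        then show ?thesis using s by linarith
      qed
      from ray_kernel_outgoing[OF \<omega> s(1) this, of \<kappa> i j] show ?thesis
        using True unfolding f_def e_def x_def by (simp flip: mult.assoc)
    next
      case False
      then show ?thesis using elim by (simp add: f_def)
    qed
    then show ?case unfolding Gi[OF y] by simp
  qed
  have int_e: "integrable ?M (\<lambda>y. \<Sum>j\<in>UNIV. e * f i j y)" for i
    using f by (intro Bochner_Integration.integrable_sum integrable_mult_right)
  have "integrable ?M (\<lambda>y. G y $ i)" for i
    by (rule integrable_cong_AE_imp[OF int_e[of i] mG], use ae[of i] in eventually_elim) simp
  then have "integrable ?M G" by (rule integrable_vec)
  then have "electric_field \<kappa> R J x $ i = (LINT y|?M. G y $ i)"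
    unfolding electric_field_def G_def by (rule integral_vec_nth)
  also have "\<dots> = (LINT y|?M. (\<Sum>j\<in>UNIV. e * f i j y))"
    by (rule integral_cong_AE[OF mG borel_measurable_integrable[OF int_e] ae])
  also have "\<dots> = e * (\<Sum>j\<in>UNIV. LINT y|?M. f i j y)"
    using f by (simp add: Bochner_Integration.integral_sum sum_distrib_left)
  finally show ?thesis unfolding x_def e_def ray_field_def f_def .
qed

text \<open>
  The term with the divergence is rewritten by testing the vanishing normal trace of \<open>J\<close> against the
  smooth function \<open>\<partial>\<^sub>i j\<^sub>0(\<kappa> |x - \<cdot>|)\<close>. This moves the derivative from \<open>J\<close> to the kernel and produces the
  dyad of \<open>j\<^sub>0\<close>, which splits into its outgoing and incoming parts.
\<close>

lemma null_space2_expression_on_ray: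
  fixes J :: "real^3 \<Rightarrow> complex^3" and i :: 3
  assumes \<omega>: "norm \<omega> = 1" and \<rho>: "0 < \<rho>" "\<rho> < R" and s: "0 < s" "s * R < 1" and \<kappa>: "\<kappa> \<noteq> 0"
    and J: "J \<in> H0_div (ball 0 R)"
    and supp: "AE y in lebesgue_on (ball 0 R). norm y > \<rho> \<longrightarrow> J y = 0"
    and x: "x = (1 / s) *\<^sub>R \<omega>"
  shows "((LINT y|lebesgue_on (ball 0 R). spherical_j0 (\<kappa> * norm (x - y)) *\<^sub>R J y)
       - (1 / \<kappa>\<^sup>2) *\<^sub>R (LINT y|lebesgue_on (ball 0 R).
            weak_div (ball 0 R) J y *s
            grad (\<lambda>z. complex_of_real (spherical_j0 (\<kappa> * norm (x - z)))) y)) $ i =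
    of_real (2 * pi / \<kappa>) / \<i> *
      (exp (\<i> * of_real (\<kappa> / s)) * ray_field \<kappa> R \<rho> J \<omega> i (of_real s) +
       exp (- (\<i> * of_real (\<kappa> / s))) * ray_field \<kappa> R \<rho> J (- \<omega>) i (- of_real s))"
proof -
  let ?M = "lebesgue_on (ball (0 :: real^3) R)"
  define \<phi> where "\<phi> = (\<lambda>z. complex_of_real (spherical_j0 (\<kappa> * norm (x - z))))"
  define d where "d = weak_div (ball 0 R) J"
  define c where "c = of_real (2 * pi / \<kappa>) / \<i>"
  define e where "e = exp (\<i> * of_real (\<kappa> / s))"
  define e' where "e' = exp (- (\<i> * of_real (\<kappa> / s)))"
  define f where "f = (\<lambda>j y. (if y \<in> cball 0 \<rho> then ray_kernel \<kappa> \<omega> i j (of_real s) y else 0) * J y $ j)"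
  define f' where "f' = (\<lambda>j y. (if y \<in> cball 0 \<rho> then ray_kernel \<kappa> (- \<omega>) i j (- of_real s) y else 0) * J y $ j)"
  have Hdiv: "J \<in> L2 (ball 0 R)" "\<exists>d. d \<in> L2 (ball 0 R) \<and> is_weak_div (ball 0 R) J d"
    using J unfolding H0_div_def H_div_def by auto
  have "d \<in> L2 (ball 0 R)"
    using someI_ex[OF Hdiv(2)] unfolding d_def weak_div_def by blast
  then have d: "integrable ?M d" by (rule L2_ball_integrable)
  have Jint: "integrable ?M J" by (rule L2_ball_integrable[OF Hdiv(1)])
  have Jj: "integrable ?M (\<lambda>y. J y $ j)" for j
    by (rule integrable_bounded_linear[OF bounded_linear_vec_nth Jint])
  note sm = smooth_spherical_j0[OF \<phi>_def]
  have \<phi>J: "integrable ?M (\<lambda>y. \<phi> y * J y $ j)" for j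
    by (rule integrable_continuous_mult[OF Jj smooth_imp_continuous[OF sm(1)]])
  have \<phi>d: "integrable ?M (\<lambda>y. partial j \<phi> y * d y)" for j
    by (rule integrable_continuous_mult[OF d smooth_imp_continuous[OF sm(2)]])
  have \<phi>JJ: "integrable ?M (\<lambda>y. partial j (partial k \<phi>) y * J y $ j)" for j k
    by (rule integrable_continuous_mult[OF Jj smooth_imp_continuous[OF sm(3)]])
  have sR: "complex_of_real s \<in> cball 0 (1 / R)" "- complex_of_real s \<in> cball 0 (1 / R)"
    using s \<rho> by (simp_all add: field_simps)
  have f: "integrable ?M (f j)" "integrable ?M (f' j)" for j
    unfolding f_def f'_def
    by (rule ray_kernel_truncated_integrable[OF _ \<rho> _ Jint]; use \<omega> sR in simp)+
  have xR: "norm x > R" unfolding x using \<omega> s \<rho> by (simp add: field_simps)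
  have int1: "(LINT y|?M. spherical_j0 (\<kappa> * norm (x - y)) *\<^sub>R J y) $ i = (LINT y|?M. \<phi> y * J y $ i)"
  proof -
    have "integrable ?M (\<lambda>y. spherical_j0 (\<kappa> * norm (x - y)) *\<^sub>R J y)"
      using \<phi>J by (intro integrable_vec) (simp add: \<phi>_def scaleR_conv_of_real[where 'a = complex])
    from integral_vec_nth[OF this] show ?thesis by (simp add: \<phi>_def scaleR_conv_of_real[where 'a = complex])
  qed
  have int2: "(LINT y|?M. d y *s grad \<phi> y) $ i = - (\<Sum>j\<in>UNIV. LINT y|?M. partial j (partial i \<phi>) y * J y $ j)"
  proof -
    have "integrable ?M (\<lambda>y. d y *s grad \<phi> y)"
      using \<phi>d by (intro integrable_vec) (simp add: grad_def mult.commute)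
    from integral_vec_nth[OF this] have "(LINT y|?M. d y *s grad \<phi> y) $ i = (LINT y|?M. d y * partial i \<phi> y)"
      by (simp add: grad_def)
    also have "\<dots> = - (LINT y|?M. bdot (J y) (grad (partial i \<phi>) y))"
    proof -
      have "normal_trace (ball 0 R) J (partial i \<phi>) = 0"
        using J sm(2) unfolding H0_div_def by blast
      then show ?thesis unfolding normal_trace_def d_def[symmetric] by (simp add: eq_neg_iff_add_eq_0 add.commute)
    qed
    also have "(LINT y|?M. bdot (J y) (grad (partial i \<phi>) y)) = (\<Sum>j\<in>UNIV. LINT y|?M. partial j (partial i \<phi>) y * J y $ j)"
      using \<phi>JJ by (simp add: bdot_def grad_def mult.commute Bochner_Integration.integral_sum)
    finally show ?thesis .
  qed
  define g where "g = (\<lambda>j y. ((if i = j then \<phi> y else 0) + of_real (1 / \<kappa>\<^sup>2) * partial j (partial i \<phi>) y) * J y $ j)"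
  have g_split: "g j = (\<lambda>y. (if i = j then \<phi> y * J y $ i else 0) + of_real (1 / \<kappa>\<^sup>2) * (partial j (partial i \<phi>) y * J y $ j))" for j
    unfolding g_def by (auto simp: algebra_simps)
  have g: "integrable ?M (g j)" for j
    unfolding g_split using \<phi>J \<phi>JJ by (intro Bochner_Integration.integrable_add integrable_mult_right) (cases "i = j", auto)
  have gint: "(LINT y|?M. g j y) = (if i = j then LINT y|?M. \<phi> y * J y $ i else 0) + of_real (1 / \<kappa>\<^sup>2) * (LINT y|?M. partial j (partial i \<phi>) y * J y $ j)" for j
    unfolding g_split using \<phi>J \<phi>JJ by (cases "i = j") simp_all
  have ray: "(LINT y|?M. g j y) = c * (e * (LINT y|?M. f j y) + e' * (LINT y|?M. f' j y))" for j
  proof -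
    have ff: "integrable ?M (\<lambda>y. c * (e * f j y + e' * f' j y))"
      using f by (intro integrable_mult_right Bochner_Integration.integrable_add)
    have "AE y in ?M. g j y = c * (e * f j y + e' * f' j y)"
      using supp AE_space
    proof eventually_elim
      case (elim y)
      then have y: "y \<in> ball 0 R" by simp
      then have xy: "x \<noteq> y" using xR by auto
      show ?case
      proof (cases "norm y \<le> \<rho>")
        case True
        have sy: "s * norm y < 1"
        proof -
          have "s * norm y < s * R" using True \<rho> s by simp
          then show ?thesis using s by linarith
        qed
        show ?thesis
          using True unfolding g_def \<phi>_def j0_dyad_eq[OF xy \<kappa>] f_def f'_def
            ray_kernel_outgoing[OF \<omega> s(1) sy, of \<kappa> i j, folded x e_def, symmetric]
            ray_kernel_incoming[OF \<omega> s(1) sy, of \<kappa> i j, folded x e'_def, symmetric]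
          by (simp add: c_def algebra_simps)
      next
        case False
        then show ?thesis using elim by (simp add: g_def f_def f'_def)
      qed
    qed
    then have "(LINT y|?M. g j y) = (LINT y|?M. c * (e * f j y + e' * f' j y))"
      by (rule integral_cong_AE[OF borel_measurable_integrable[OF g] borel_measurable_integrable[OF ff]])
    then show ?thesis using f by simp
  qed
  have "((LINT y|?M. spherical_j0 (\<kappa> * norm (x - y)) *\<^sub>R J y) - (1 / \<kappa>\<^sup>2) *\<^sub>R (LINT y|?M. d y *s grad \<phi> y)) $ i
      = (LINT y|?M. \<phi> y * J y $ i) + of_real (1 / \<kappa>\<^sup>2) * (\<Sum>j\<in>UNIV. LINT y|?M. partial j (partial i \<phi>) y * J y $ j)"
    unfolding vector_minus_component vector_scaleR_component int1 int2 by (simp add: scaleR_conv_of_real[where 'a = complex])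
  also have "\<dots> = (\<Sum>j\<in>UNIV. LINT y|?M. g j y)"
    unfolding gint by (simp add: sum.distrib sum_distrib_left)
  also have "\<dots> = c * (e * (\<Sum>j\<in>UNIV. LINT y|?M. f j y) + e' * (\<Sum>j\<in>UNIV. LINT y|?M. f' j y))"
    unfolding ray by (simp add: sum.distrib sum_distrib_left distrib_left)
  finally show ?thesis
    unfolding \<phi>_def d_def c_def e_def e'_def ray_field_def f_def f'_def .
qed

section \<open>Nonradiating sources and the null space\<close>

theorem theorem3p10:
  fixes \<kappa> R :: real and J :: "real^3 \<Rightarrow> complex^3"
  assumes "\<kappa> > 0" and "R > 0"
    and "J \<in> H0_div (ball 0 R)"
    and "compactly_supported_in J (ball 0 R)"
  shows "nonradiating \<kappa> R J \<longleftrightarrow> J \<in> null_space2 \<kappa> R"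
proof -
  obtain \<rho> where \<rho>: "0 < \<rho>" "\<rho> < R" and supp: "AE y in lebesgue_on (ball 0 R). norm y > \<rho> \<longrightarrow> J y = 0"
    using compactly_supported_in_ballE[OF assms(4,2)] .
  \<comment> \<open>A radius strictly between \<open>\<rho>\<close> and \<open>R\<close>, so that the disc of holomorphy contains \<open>1 / R\<close>; this value of \<open>s\<close>
    corresponds to the points of the sphere.\<close>
  define \<rho>' where "\<rho>' = (\<rho> + R) / 2"
  have \<rho>': "\<rho> < \<rho>'" "\<rho>' < R" "0 < \<rho>'" unfolding \<rho>'_def using \<rho> by auto
  then have inv: "0 < 1 / R" "1 / R < 1 / \<rho>'" using assms(2) by (auto simp: field_simps)
  have \<kappa>0: "\<kappa> \<noteq> 0" using assms(1) by simp
  have "J \<in> L2 (ball 0 R)" using assms(3) unfolding H0_div_def H_div_def by blast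
  then have J: "integrable (lebesgue_on (ball 0 R)) J" by (rule L2_ball_integrable)
  let ?A = "ray_field \<kappa> R \<rho> J"
  define N where "N = (\<lambda>x. (LINT y|lebesgue_on (ball 0 R). spherical_j0 (\<kappa> * norm (x - y)) *\<^sub>R J y)
       - (1 / \<kappa>\<^sup>2) *\<^sub>R (LINT y|lebesgue_on (ball 0 R). weak_div (ball 0 R) J y *s
            grad (\<lambda>z. complex_of_real (spherical_j0 (\<kappa> * norm (x - z)))) y))"
  have hol: "?A \<omega> i holomorphic_on ball 0 (1 / \<rho>')" if "norm \<omega> = 1" for \<omega> i
    by (rule holomorphic_on_ray_field[OF that \<rho>(1) \<rho>'(1) J])
  have E: "electric_field \<kappa> R J ((1 / s) *\<^sub>R \<omega>) $ i = exp (\<i> * of_real (\<kappa> / s)) * ?A \<omega> i (of_real s)"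
    if "norm \<omega> = 1" "0 < s" "s \<le> 1 / R" for \<omega> s i
    by (rule electric_field_on_ray[OF that(1) \<rho> that(2) _ \<kappa>0 J supp]) (use that assms(2) in \<open>simp add: field_simps\<close>)
  have N: "N ((1 / s) *\<^sub>R \<omega>) $ i = of_real (2 * pi / \<kappa>) / \<i> *
      (exp (\<i> * of_real (\<kappa> / s)) * ?A \<omega> i (of_real s) + exp (- (\<i> * of_real (\<kappa> / s))) * ?A (- \<omega>) i (- of_real s))"
    if "norm \<omega> = 1" "0 < s" "s < 1 / R" for \<omega> s i
    unfolding N_def
    by (rule null_space2_expression_on_ray[OF that(1) \<rho> that(2) _ \<kappa>0 assms(3) supp refl]) (use that assms(2) in \<open>simp add: field_simps\<close>)
  have polar: "x = (1 / (1 / norm x)) *\<^sub>R ((1 / norm x) *\<^sub>R x)" "norm ((1 / norm x) *\<^sub>R x) = 1" if "x \<noteq> 0" for x :: "real^3"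
    using that by simp_all
  have nr: "nonradiating \<kappa> R J \<longleftrightarrow> (\<forall>\<omega> i. norm \<omega> = 1 \<longrightarrow> (\<forall>s\<in>ball 0 (1 / \<rho>'). ?A \<omega> i s = 0))"
  proof
    assume "nonradiating \<kappa> R J"
    then have E0: "electric_field \<kappa> R J x = 0" if "norm x \<ge> R" for x
      using that unfolding nonradiating_def by simp
    show "\<forall>\<omega> i. norm \<omega> = 1 \<longrightarrow> (\<forall>s\<in>ball 0 (1 / \<rho>'). ?A \<omega> i s = 0)"
    proof (intro allI impI ballI)
      fix \<omega> :: "real^3" and i z assume \<omega>: "norm \<omega> = 1" and z: "z \<in> ball (0 :: complex) (1 / \<rho>')"
      show "?A \<omega> i z = 0"
      proof (rule holomorphic_zero_on_real_segment[OF hol[OF \<omega>] open_ball connected_ball inv(1) _ _ z])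
        fix s assume s: "0 < s" "s < 1 / R"
        show "complex_of_real s \<in> ball 0 (1 / \<rho>')" using s inv by simp
        have "electric_field \<kappa> R J ((1 / s) *\<^sub>R \<omega>) = 0"
          using s assms(2) \<omega> by (intro E0) (simp add: field_simps)
        then show "?A \<omega> i (of_real s) = 0" using E[OF \<omega> s(1), of i] s(2) by simp
      qed
    qed
  next
    assume A: "\<forall>\<omega> i. norm \<omega> = 1 \<longrightarrow> (\<forall>s\<in>ball 0 (1 / \<rho>'). ?A \<omega> i s = 0)"
    have "electric_field \<kappa> R J x = 0" if x: "x \<notin> ball 0 R" for x
    proof -
      have x0: "x \<noteq> 0" using x assms(2) by auto
      have s: "0 < 1 / norm x" "1 / norm x \<le> 1 / R" using x x0 assms(2) by (auto simp: field_simps)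
      have "electric_field \<kappa> R J x $ i = 0" for i
      proof -
        have "complex_of_real (1 / norm x) \<in> ball 0 (1 / \<rho>')"
          using s inv by (simp only: mem_ball_0 norm_of_real)
        with A polar(2)[OF x0] have "?A ((1 / norm x) *\<^sub>R x) i (of_real (1 / norm x)) = 0" by blast
        then show ?thesis using E[OF polar(2)[OF x0] s, of i] unfolding polar(1)[OF x0, symmetric] by simp
      qed
      then show ?thesis by (simp add: vec_eq_iff)
    qed
    then show "nonradiating \<kappa> R J" unfolding nonradiating_def using assms(4) by blast
  qed
  have ns: "J \<in> null_space2 \<kappa> R \<longleftrightarrow> (\<forall>\<omega> i s. norm \<omega> = 1 \<longrightarrow> 0 < s \<longrightarrow> s < 1 / R \<longrightarrow>
      exp (\<i> * of_real (\<kappa> / s)) * ?A \<omega> i (of_real s) + exp (- (\<i> * of_real (\<kappa> / s))) * ?A (- \<omega>) i (- of_real s) = 0)"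
    (is "_ \<longleftrightarrow> ?rhs")
  proof
    assume "J \<in> null_space2 \<kappa> R"
    then have N0: "N x = 0" if "norm x > R" for x
      using that unfolding null_space2_def N_def by blast
    show ?rhs
    proof (intro allI impI)
      fix \<omega> :: "real^3" and i s assume h: "norm \<omega> = 1" "0 < s" "s < 1 / R"
      have "N ((1 / s) *\<^sub>R \<omega>) = 0" using h assms(2) by (intro N0) (simp add: field_simps)
      then show "exp (\<i> * of_real (\<kappa> / s)) * ?A \<omega> i (of_real s) + exp (- (\<i> * of_real (\<kappa> / s))) * ?A (- \<omega>) i (- of_real s) = 0"
        using N[OF h, of i] \<kappa>0 by simp
    qed
  next
    assume A: ?rhs
    have "N x = 0" if x: "norm x > R" for x
    proof -
      have x0: "x \<noteq> 0" using x assms(2) by auto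
      have s: "0 < 1 / norm x" "1 / norm x < 1 / R" using x x0 assms(2) by (auto simp: field_simps)
      have "N ((1 / (1 / norm x)) *\<^sub>R ((1 / norm x) *\<^sub>R x)) $ i = 0" for i
        using N[OF polar(2)[OF x0] s, of i] A[rule_format, OF polar(2)[OF x0] s, of i] by (simp only: mult_zero_right)
      then show ?thesis unfolding polar(1)[OF x0, symmetric] vec_eq_iff by simp
    qed
    then show "J \<in> null_space2 \<kappa> R" using assms(3) unfolding null_space2_def N_def by blast
  qed
  show ?thesis
    unfolding nr ns
  proof
    assume A: "\<forall>\<omega> i. norm \<omega> = 1 \<longrightarrow> (\<forall>s\<in>ball 0 (1 / \<rho>'). ?A \<omega> i s = 0)"
    have "?A \<omega> i s = 0" if "norm \<omega> = 1" "norm s < 1 / R" for \<omega> i s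
      using A that inv by simp
    then show "\<forall>\<omega> i s. norm \<omega> = 1 \<longrightarrow> 0 < s \<longrightarrow> s < 1 / R \<longrightarrow>
      exp (\<i> * of_real (\<kappa> / s)) * ?A \<omega> i (of_real s) + exp (- (\<i> * of_real (\<kappa> / s))) * ?A (- \<omega>) i (- of_real s) = 0"
      by simp
  next
    assume A: "\<forall>\<omega> i s. norm \<omega> = 1 \<longrightarrow> 0 < s \<longrightarrow> s < 1 / R \<longrightarrow>
      exp (\<i> * of_real (\<kappa> / s)) * ?A \<omega> i (of_real s) + exp (- (\<i> * of_real (\<kappa> / s))) * ?A (- \<omega>) i (- of_real s) = 0"
    show "\<forall>\<omega> i. norm \<omega> = 1 \<longrightarrow> (\<forall>s\<in>ball 0 (1 / \<rho>'). ?A \<omega> i s = 0)"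
    proof (intro allI impI ballI)
      fix \<omega> :: "real^3" and i z assume \<omega>: "norm \<omega> = 1" and z: "z \<in> ball (0 :: complex) (1 / \<rho>')"
      have "norm (- \<omega>) = 1" using \<omega> by simp
      then have hol': "(\<lambda>s. ?A (- \<omega>) i (- s)) holomorphic_on ball 0 (1 / \<rho>')"
        by (intro holomorphic_on_compose_gen[OF _ hol, unfolded o_def] holomorphic_intros) auto
      show "?A \<omega> i z = 0"
        by (rule exp_essential_singularity_imp_zero[OF hol[OF \<omega>] hol' assms(1) inv(1) _ _ z])
           (use A \<omega> inv in auto)
    qed
  qed
qed

end
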